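(* Let $k>0$, $c>0$, $\nu>0$ and $\alpha\in[0,1)$. (a) The radius of convexity of order $\alpha$ of the function ${}_{k}f_{\nu,c}$ is the smallest positive root of the equation $$1+r\frac{{}_{k}W_{\nu,c}''(r)}{{}_{k}W_{\nu,c}'(r)}+\left(\frac{k}{\nu}-1\right)r\frac{{}_{k}W_{\nu,c}'(r)}{{}_{k}W_{\nu,c}(r)}=\alpha.$$ (b) The radius of convexity of order $\alpha$ of the function ${}_{k}g_{\nu,c}$ is the smallest positive root of the equation $$1+r\frac{{}_{k}g_{\nu,c}''(r)}{{}_{k}g_{\nu,c}'(r)}=\alpha.$$ (c) The radius of convexity of order $\alpha$ of the function ${}_{k}h_{\nu,c}$ is the smallest positive root of the equation $$1+r\frac{{}_{k}h_{\nu,c}''(r)}{{}_{k}h_{\nu,c}'(r)}=\alpha.$$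
   Context: For $k>0$ the $k$-gamma function is $\Gamma_{k}(z)=\int_{0}^{\infty}t^{z-1}e^{-t^{k}/k}\,dt$ for $\operatorname{Re}(z)>0$; equivalently $\Gamma_k(z)=k^{\frac{z}{k}-1}\Gamma\left(\frac{z}{k}\right)$. The generalized $k$-Bessel function of order $\nu$ is $${}_{k}W_{\nu,c}(z)=\sum_{n=0}^{\infty}\frac{(-c)^n}{n!\,\Gamma_{k}(nk+\nu+k)}\left(\frac{z}{2}\right)^{2n+\frac{\nu}{k}}.$$ Its normalized forms are $${}_{k}f_{\nu,c}(z)=\left(2^{\frac{\nu}{k}}\Gamma_{k}(\nu+k)\,{}_{k}W_{\nu,c}(z)\right)^{\frac{k}{\nu}},\quad {}_{k}g_{\nu,c}(z)=2^{\frac{\nu}{k}}\Gamma_{k}(\nu+k)z^{1-\frac{\nu}{k}}{}_{k}W_{\nu,c}(z),\quad {}_{k}h_{\nu,c}(z)=2^{\frac{\nu}{k}}\Gamma_{k}(\nu+k)z^{1-\frac{\nu}{2k}}{}_{k}W_{\nu,c}(\sqrt{z}).$$ Multivalued functions are taken with the principal branch, so that each of these three functions is analytic near $0$ with value $0$ and derivative $1$ at $0$. Explicitly, with the entire function $w(z)=\Gamma_k(\nu+k)\sum_{n\ge0}\frac{(-c)^n}{n!\,\Gamma_k(nk+\nu+k)}\left(\frac{z}{2}\right)^{2n}$, $w(0)=1$, one has ${}_{k}g_{\nu,c}(z)=z\,w(z)$, ${}_{k}h_{\nu,c}(z)=z\,w(\sqrt z)$ (both entire), and ${}_{k}f_{\nu,c}(z)=z\,w(z)^{k/\nu}$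 with the analytic branch of the power equal to $1$ at $z=0$, in the largest disk centered at $0$ where $w$ has no zeros. Let $\mathbb{D}_r=\{z\in\mathbb{C}:|z|<r\}$. For $f$ analytic near $0$ with $f(0)=f'(0)-1=0$, the radius of convexity of order $\alpha$ is $$r_{\alpha}^{c}(f)=\sup\left\{r>0:\ \operatorname{Re}\left(1+\frac{zf''(z)}{f'(z)}\right)>\alpha\ \text{for all } z\in\mathbb{D}_r\right\},$$ where $r$ ranges over values not exceeding the radius of convergence of the Taylor series of $f$ at $0$. *)

theory Defs
  imports "HOL-Complex_Analysis.Complex_Analysis"
begin

definition k_Gamma :: "real \<Rightarrow> complex \<Rightarrow> complex" where
  "k_Gamma k z =
     integral {0..} (\<lambda>t::real. of_real t powr (z - 1) * of_real (exp (- (t powr k) / k)))"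

definition k_Bessel_W :: "real \<Rightarrow> real \<Rightarrow> real \<Rightarrow> complex \<Rightarrow> complex" where
  "k_Bessel_W k \<nu> c z =
     (\<Sum>n. of_real ((- c) ^ n) / (fact n * k_Gamma k (of_real (real n * k + \<nu> + k)))
             * (z / 2) powr of_real (2 * real n + \<nu> / k))"

definition k_Bessel_g :: "real \<Rightarrow> real \<Rightarrow> real \<Rightarrow> complex \<Rightarrow> complex" where
  "k_Bessel_g k \<nu> c z =
     of_real (2 powr (\<nu> / k)) * k_Gamma k (of_real (\<nu> + k))
       * z powr of_real (1 - \<nu> / k) * k_Bessel_W k \<nu> c z"

definition k_Bessel_h :: "real \<Rightarrow> real \<Rightarrow> real \<Rightarrow> complex \<Rightarrow> complex" where
  "k_Bessel_h k \<nu> c z =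
     of_real (2 powr (\<nu> / k)) * k_Gamma k (of_real (\<nu> + k))
       * z powr of_real (1 - \<nu> / (2 * k)) * k_Bessel_W k \<nu> c (csqrt z)"

text \<open>The entire function \<open>w\<close> with \<open>w 0 = 1\<close> and
  \<open>2\<^sup>a \<Gamma>\<^sub>k(\<nu> + k) W(z) = z\<^sup>a w(z)\<close>, where \<open>a = \<nu>/k\<close>.\<close>

definition k_Bessel_w :: "real \<Rightarrow> real \<Rightarrow> real \<Rightarrow> complex \<Rightarrow> complex" where
  "k_Bessel_w k \<nu> c z =
     k_Gamma k (of_real (\<nu> + k)) *
     (\<Sum>n. of_real ((- c) ^ n) / (fact n * k_Gamma k (of_real (real n * k + \<nu> + k)))
             * (z / 2) ^ (2 * n))"

text \<open>The largest disk centred at \<open>0\<close> on which \<open>w\<close> has no zeros, and the analytic branch of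
  \<open>log w\<close> there that vanishes at \<open>0\<close>. It is unique on the disk, and only its values there matter.\<close>

definition k_Bessel_disk :: "real \<Rightarrow> real \<Rightarrow> real \<Rightarrow> complex set" where
  "k_Bessel_disk k \<nu> c = \<Union> {ball 0 r | r. \<forall>z\<in>ball 0 r. k_Bessel_w k \<nu> c z \<noteq> 0}"

definition k_Bessel_log_w :: "real \<Rightarrow> real \<Rightarrow> real \<Rightarrow> complex \<Rightarrow> complex" where
  "k_Bessel_log_w k \<nu> c =
     (SOME L. L holomorphic_on k_Bessel_disk k \<nu> c \<and> L 0 = 0 \<and>
        (\<forall>z\<in>k_Bessel_disk k \<nu> c. exp (L z) = k_Bessel_w k \<nu> c z))"

text \<open>\<open>(2\<^sup>a \<Gamma>\<^sub>k(\<nu> + k) W(z))\<close> raised to \<open>1/a\<close>, in the branch \<open>z w(z)\<^bsup>1/a\<^esup>\<close> that is analytic near \<open>0\<close>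
  with derivative \<open>1\<close> there. Two nested applications of the principal power would not be analytic
  near \<open>0\<close> when \<open>a > 1\<close>.\<close>

definition k_Bessel_f :: "real \<Rightarrow> real \<Rightarrow> real \<Rightarrow> complex \<Rightarrow> complex" where
  "k_Bessel_f k \<nu> c z = z * exp (of_real (k / \<nu>) * k_Bessel_log_w k \<nu> c z)"

text \<open>For \<open>f\<close> analytic near \<open>0\<close>. Inside its disk of convergence \<open>f\<close> is identified with the sum
  \<open>F\<close> of its Taylor series, so only the germ of \<open>f\<close> at \<open>0\<close> matters. The condition \<open>F' z \<noteq> 0\<close> makes
  the quotient \<open>z F''(z) / F'(z)\<close> meaningful; since division by zero gives zero, a zero of \<open>F'\<close> would
  otherwise satisfy the inequality.\<close>

definition radius_of_convexity :: "real \<Rightarrow> (complex \<Rightarrow> complex) \<Rightarrow> ereal" where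
  "radius_of_convexity \<alpha> f =
     (let F = eval_fps (fps_expansion f 0) in
      Sup (ereal ` {r. 0 < r \<and> ereal r \<le> fps_conv_radius (fps_expansion f 0) \<and>
             (\<forall>z\<in>ball 0 r. deriv F z \<noteq> 0 \<and> Re (1 + z * deriv (deriv F) z / deriv F z) > \<alpha>)}))"

definition is_smallest_pos :: "(real \<Rightarrow> bool) \<Rightarrow> real \<Rightarrow> bool" where
  "is_smallest_pos P r \<longleftrightarrow> 0 < r \<and> P r \<and> (\<forall>s. 0 < s \<and> P s \<longrightarrow> r \<le> s)"

text \<open>The functions are real on the positive axis; the left-hand sides of the equations are
  formed with complex derivatives at the real point \<open>r\<close>. An \<open>r\<close> at which a denominator vanishes
  is not a root.\<close>

definition convexity_eq_W :: "real \<Rightarrow> real \<Rightarrow> real \<Rightarrow> real \<Rightarrow> real \<Rightarrow> bool" where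
  "convexity_eq_W k \<nu> c \<alpha> r \<longleftrightarrow>
     (let W = k_Bessel_W k \<nu> c; x = complex_of_real r in
      deriv W x \<noteq> 0 \<and> W x \<noteq> 0 \<and>
      1 + x * (deriv (deriv W) x / deriv W x)
        + of_real (k / \<nu> - 1) * x * (deriv W x / W x) = of_real \<alpha>)"

definition convexity_eq :: "(complex \<Rightarrow> complex) \<Rightarrow> real \<Rightarrow> real \<Rightarrow> bool" where
  "convexity_eq f \<alpha> r \<longleftrightarrow>
     (let x = complex_of_real r in
      deriv f x \<noteq> 0 \<and> 1 + x * (deriv (deriv f) x / deriv f x) = of_real \<alpha>)"

end

theory Submission
  imports Defs
begin

text \<open>
  Put \<open>a = \<nu> / k\<close> and \<open>q = c / (4 k)\<close>. By \<open>\<Gamma>\<^sub>k(x) = k\<^bsup>x/k-1\<^esup> \<Gamma>(x/k)\<close> the entire function \<open>w\<close> is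
  \<open>\<phi>(q z\<^sup>2)\<close>, where \<open>\<phi>(u) = \<Sum>n. (-u)\<^sup>n / (n! (a+1)\<^sub>n)\<close> is a classical Bessel function in disguise, and
  \<open>g = z \<phi>(q z\<^sup>2)\<close>, \<open>h = z \<phi>(q z)\<close>, \<open>f = z \<phi>(q z\<^sup>2)\<^bsup>1/a\<^esup>\<close>.

  The usual argument expands the logarithmic derivatives over the zeros of \<open>f'\<close>, \<open>g'\<close>, \<open>h'\<close>, which
  requires the reality and the interlacing of these zeros. The proof below replaces this by the
  positivity of Taylor coefficients. The function \<open>p = - \<phi>' / \<phi>\<close> satisfies the Riccati equation
  \<open>u p' + (a + 1) p = 1 + u p\<^sup>2\<close>, which exhibits its Taylor coefficients as nonnegative
  (\<open>nonneg_bessel_p_series\<close>). In each of the three cases the derivative is a product \<open>E (1 - \<psi>)\<close>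
  with \<open>\<psi> = \<gamma> u p\<close> and \<open>z E' / E = - m \<beta> u p\<close> at \<open>u = q z\<^sup>m\<close>, so
  \<open>1 + z F'' / F' = 1 - K(u)\<close> where \<open>K = m u (\<beta> p + \<psi>' / (1 - \<psi>))\<close> again has nonnegative
  coefficients (\<open>convexity_series_fps\<close>). The parameters \<open>(m, \<beta>, \<gamma>)\<close> are \<open>(2, 1/a, 2/a)\<close> for \<open>f\<close>,
  \<open>(2, 1, 2)\<close> for \<open>g\<close> and \<open>(1, 1, 1)\<close> for \<open>h\<close>.

  Nonnegative coefficients give \<open>Re K(u) \<le> K(\<bar>u\<bar>)\<close>. So if \<open>u\<^sub>0\<close> is the first positive point with
  \<open>K(u\<^sub>0) = 1 - \<alpha>\<close>, the convexity inequality holds for \<open>\<bar>u\<bar> < u\<^sub>0\<close> and fails at \<open>u\<^sub>0\<close>: the radius is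
  the first root (\<open>radius_of_convexity_eqI\<close>, \<open>smallest_convexity_root\<close>). That the root exists before
  any denominator vanishes follows from \<open>K \<ge> \<psi> / (1 - \<psi>)\<close> once \<open>\<psi>\<close> reaches \<open>1/2\<close>, and it does
  because \<open>u p(u)\<close> is unbounded below the first zero of \<open>\<phi>\<close>
  (\<open>bessel_p_times_argument_unbounded\<close>, \<open>exists_convexity_root\<close>).
\<close>

section \<open>Power series with nonnegative coefficients\<close>

definition nonneg_fps :: "complex fps \<Rightarrow> bool" where
  "nonneg_fps F \<longleftrightarrow> (\<forall>n. fps_nth F n \<in> \<real>\<^sub>\<ge>\<^sub>0)"

lemma nonneg_Reals_sum: "(\<And>i. i \<in> I \<Longrightarrow> f i \<in> \<real>\<^sub>\<ge>\<^sub>0) \<Longrightarrow> sum f I \<in> \<real>\<^sub>\<ge>\<^sub>0"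
  for f :: "'b \<Rightarrow> 'a :: real_algebra_1"
  by (induction I rule: infinite_finite_induct) auto

lemma nonneg_fps_add: "nonneg_fps F \<Longrightarrow> nonneg_fps G \<Longrightarrow> nonneg_fps (F + G)"
  by (simp add: nonneg_fps_def)

lemma nonneg_fps_mult: "nonneg_fps F \<Longrightarrow> nonneg_fps G \<Longrightarrow> nonneg_fps (F * G)"
  by (auto simp: nonneg_fps_def fps_mult_nth intro!: nonneg_Reals_sum)

lemma nonneg_fps_const: "0 \<le> r \<Longrightarrow> nonneg_fps (fps_const (of_real r))"
  by (auto simp: nonneg_fps_def)

lemma nonneg_fps_X: "nonneg_fps fps_X"
  by (auto simp: nonneg_fps_def fps_X_def)

lemma nonneg_fps_deriv: "nonneg_fps F \<Longrightarrow> nonneg_fps (fps_deriv F)"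
  unfolding nonneg_fps_def fps_deriv_nth by (intro allI nonneg_Reals_mult_I nonneg_Reals_of_nat_I) auto

text \<open>The geometric series \<open>1 + F + F\<^sup>2 + \<dots>\<close> has nonnegative coefficients. Reading
  \<open>G = 1 + F G\<close> as a recursion for the coefficients of \<open>G = 1 / (1 - F)\<close> avoids the infinite sum.\<close>

lemma nonneg_fps_inverse_one_minus:
  assumes F: "nonneg_fps F" and F0: "fps_nth F 0 = 0"
  shows "nonneg_fps (inverse (1 - F))"
proof -
  let ?G = "inverse (1 - F)"
  have "(1 - F) * ?G = 1"
    by (rule inverse_mult_eq_1') (simp add: F0)
  hence G: "?G = 1 + F * ?G"
    by (simp add: algebra_simps)
  have "fps_nth ?G n \<in> \<real>\<^sub>\<ge>\<^sub>0" for n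
  proof (induction n rule: less_induct)
    case (less n)
    have *: "fps_nth F i * fps_nth ?G (n - i) \<in> \<real>\<^sub>\<ge>\<^sub>0" if "i \<le> n" for i
    proof (cases "i = 0")
      case False
      with that have "n - i < n" by simp
      with less F show ?thesis by (simp add: nonneg_fps_def)
    qed (simp add: F0)
    have "fps_nth ?G n = fps_nth (1 + F * ?G) n" using G by simp
    also have "\<dots> \<in> \<real>\<^sub>\<ge>\<^sub>0"
      using * by (auto simp: fps_mult_nth intro!: nonneg_Reals_add_I nonneg_Reals_sum)
    finally show ?case .
  qed
  thus ?thesis by (simp add: nonneg_fps_def)
qed

lemma nonneg_fps_coeff: "nonneg_fps F \<Longrightarrow> fps_nth F n = of_real (norm (fps_nth F n))"
  unfolding nonneg_fps_def by (metis abs_of_nonneg nonneg_Reals_cases norm_of_real)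

lemma eval_nonneg_fps_of_real:
  assumes "nonneg_fps F" "0 \<le> x" "ereal x < fps_conv_radius F"
  shows "eval_fps F (of_real x) = of_real (\<Sum>n. norm (fps_nth F n) * x ^ n)"
    and "summable (\<lambda>n. norm (fps_nth F n) * x ^ n)"
proof -
  have eq: "fps_nth F n * of_real x ^ n = of_real (norm (fps_nth F n) * x ^ n)" for n
    using nonneg_fps_coeff[OF assms(1), of n] by simp
  show S: "summable (\<lambda>n. norm (fps_nth F n) * x ^ n)"
    using norm_summable_fps[of "of_real x" F] assms by (simp add: norm_mult norm_power)
  show "eval_fps F (of_real x) = of_real (\<Sum>n. norm (fps_nth F n) * x ^ n)"
    unfolding eval_fps_def eq using S by (rule suminf_of_real[symmetric])
qed

lemma eval_nonneg_fps_eq_Re: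
  "nonneg_fps F \<Longrightarrow> 0 \<le> x \<Longrightarrow> ereal x < fps_conv_radius F \<Longrightarrow>
     eval_fps F (of_real x) = of_real (Re (eval_fps F (of_real x)))"
  by (simp add: eval_nonneg_fps_of_real)

text \<open>The triangle inequality for a series with nonnegative coefficients: on a disk, it is largest at
  the positive point of the boundary circle. This is what makes the extremal point of the convexity
  condition lie on the positive axis.\<close>

lemma norm_eval_nonneg_fps_le:
  assumes "nonneg_fps F" "norm z \<le> x" "ereal x < fps_conv_radius F"
  shows "norm (eval_fps F z) \<le> Re (eval_fps F (of_real x))"
proof -
  have x: "0 \<le> x" using assms(2) norm_ge_zero order_trans by blast
  have z: "ereal (norm z) < fps_conv_radius F"
    using assms by (meson ereal_less_eq(3) order.strict_trans1)
  have S: "summable (\<lambda>n. norm (fps_nth F n * z ^ n))" by (rule norm_summable_fps[OF z])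
  have "norm (eval_fps F z) \<le> (\<Sum>n. norm (fps_nth F n * z ^ n))"
    unfolding eval_fps_def by (rule summable_norm[OF S])
  also have "\<dots> \<le> (\<Sum>n. norm (fps_nth F n) * x ^ n)"
    using assms x by (intro suminf_le S eval_nonneg_fps_of_real)
      (auto simp: norm_mult norm_power intro!: mult_left_mono power_mono)
  also have "\<dots> = Re (eval_fps F (of_real x))"
    using assms x by (simp add: eval_nonneg_fps_of_real)
  finally show ?thesis .
qed

lemma Re_eval_nonneg_fps_ge_0:
  assumes "nonneg_fps F" "0 \<le> x" "ereal x < fps_conv_radius F"
  shows "0 \<le> Re (eval_fps F (of_real x))"
  using norm_eval_nonneg_fps_le[of F "of_real x" x] assms norm_ge_zero[of "eval_fps F (of_real x)"]
  by (simp del: norm_ge_zero)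

lemma Re_eval_nonneg_fps_ge_coeff:
  assumes "nonneg_fps F" "0 \<le> x" "ereal x < fps_conv_radius F"
  shows "Re (fps_nth F 0) \<le> Re (eval_fps F (of_real x))"
  using norm_eval_nonneg_fps_le[of F 0 x] assms complex_Re_le_cmod[of "fps_nth F 0"]
  by (simp add: eval_fps_at_0)

section \<open>Rayleigh sums of the Bessel function\<close>

text \<open>The series of \<open>\<phi>(u) = \<Gamma>(a + 1) u\<^bsup>-a/2\<^esup> J\<^sub>a(2 \<surd>u)\<close>, where \<open>J\<^sub>a\<close> is the Bessel function of the
  first kind. Working in \<open>u\<close> removes both the branch point of \<open>J\<^sub>a\<close> at \<open>0\<close> and the odd powers.\<close>

definition bessel_fps :: "real \<Rightarrow> complex fps" where
  "bessel_fps a = Abs_fps (\<lambda>n. (-1) ^ n / (fact n * pochhammer (of_real a + 1) n))"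

lemma pochhammer_real_plus_1_nonzero:
  assumes "a > 0" shows "pochhammer (of_real a + 1 :: complex) n \<noteq> 0"
proof -
  have "pochhammer (a + 1) n > 0" using assms by (intro pochhammer_pos) auto
  moreover have "pochhammer (of_real a + 1 :: complex) n = of_real (pochhammer (a + 1) n)"
    by (metis of_real_1 of_real_add pochhammer_of_real)
  ultimately show ?thesis by simp
qed

lemma bessel_fps_Suc:
  assumes "a > 0"
  shows "of_nat (Suc n) * (of_nat n + (of_real a + 1)) * fps_nth (bessel_fps a) (Suc n)
           = - fps_nth (bessel_fps a) n"
proof -
  define u v w :: complex
    where "u = of_nat (Suc n)" and "v = of_nat n + (of_real a + 1)" and "w = pochhammer (of_real a + 1) n"
  have nz: "u \<noteq> 0" "v \<noteq> 0" "w \<noteq> 0"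
    using pochhammer_real_plus_1_nonzero[OF assms, of "Suc n"]
    by (auto simp: pochhammer_Suc add_ac u_def v_def w_def simp del: of_nat_Suc)
  have A: "fps_nth (bessel_fps a) (Suc n) = - ((-1) ^ n / (u * fact n * (w * v)))"
    by (simp add: bessel_fps_def pochhammer_Suc u_def v_def w_def algebra_simps)
  have B: "fps_nth (bessel_fps a) n = (-1) ^ n / (fact n * w)"
    by (simp add: bessel_fps_def w_def)
  show ?thesis
    using nz unfolding A B u_def[symmetric] v_def[symmetric] by (simp add: field_simps)
qed

lemma fps_conv_radius_bessel [simp]:
  assumes "a > 0"
  shows "fps_conv_radius (bessel_fps a) = \<infinity>"
  unfolding fps_conv_radius_def
proof (rule conv_radius_ratio_limit_ereal)
  have nz: "fps_nth (bessel_fps a) n \<noteq> 0" for n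
    using pochhammer_real_plus_1_nonzero[OF assms] by (simp add: bessel_fps_def)
  thus "\<forall>\<^sub>F n in sequentially. fps_nth (bessel_fps a) n \<noteq> 0" by simp
  have "norm (fps_nth (bessel_fps a) n) / norm (fps_nth (bessel_fps a) (Suc n))
          = real (Suc n) * (real n + (a + 1))" for n
  proof -
    have "norm (fps_nth (bessel_fps a) n)
            = norm (of_nat (Suc n) * (of_nat n + (of_real a + 1)) * fps_nth (bessel_fps a) (Suc n))"
      by (subst bessel_fps_Suc[OF assms]) simp
    also have "of_nat (Suc n) * (of_nat n + (of_real a + 1)) =
        complex_of_real (real (Suc n) * (real n + (a + 1)))"
      by simp
    also have "norm (\<dots> * fps_nth (bessel_fps a) (Suc n))
        = real (Suc n) * (real n + (a + 1)) * norm (fps_nth (bessel_fps a) (Suc n))"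
      using assms by (simp only: norm_mult norm_of_real) simp
    finally show ?thesis using nz[of "Suc n"] by (simp add: field_simps)
  qed
  moreover have "filterlim (\<lambda>n. real (Suc n) * (real n + (a + 1))) at_top sequentially"
  proof (rule filterlim_at_top_mono[OF filterlim_real_sequentially always_eventually[OF allI]])
    fix n show "real n \<le> real (Suc n) * (real n + (a + 1))"
      using mult_mono[of 1 "real (Suc n)" "real n" "real n + (a + 1)"] assms by simp
  qed
  ultimately show "(\<lambda>n. ereal (norm (fps_nth (bessel_fps a) n) / norm (fps_nth (bessel_fps a) (Suc n)))) \<longlonglongrightarrow> \<infinity>"
    by (simp add: tendsto_PInfty_eq_at_top)
qed

text \<open>Bessel's differential equation, transformed to the variable \<open>u\<close>.\<close>

lemma bessel_fps_ode:
  assumes "a > 0"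
  defines "B \<equiv> bessel_fps a"
  shows "fps_X * fps_deriv (fps_deriv B) + fps_const (of_real a + 1) * fps_deriv B + B = 0"
proof (rule fps_ext)
  fix n
  show "fps_nth (fps_X * fps_deriv (fps_deriv B) + fps_const (of_real a + 1) * fps_deriv B + B) n
          = fps_nth 0 n"
    using bessel_fps_Suc[OF assms(1), of n, folded B_def]
    by (cases n) (simp_all add: algebra_simps)
qed

text \<open>The formal series of \<open>p = - \<phi>' / \<phi>\<close>. Its coefficients are the Rayleigh sums, that is, the
  sums of \<open>\<zeta>\<^bsup>-n-1\<^esup>\<close> over the zeros \<open>\<zeta>\<close> of \<open>\<phi>\<close>.\<close>

definition bessel_p_series :: "real \<Rightarrow> complex fps" where
  "bessel_p_series a = - fps_deriv (bessel_fps a) * inverse (bessel_fps a)"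

lemma bessel_fps_0 [simp]: "fps_nth (bessel_fps a) 0 = 1"
  by (simp add: bessel_fps_def)

text \<open>Dividing Bessel's equation by \<open>\<phi>\<close> and using \<open>p' = p\<^sup>2 - \<phi>'' / \<phi>\<close> turns it into a first-order
  equation for \<open>p\<close>.\<close>

lemma bessel_p_series_riccati:
  assumes "a > 0"
  defines "P \<equiv> bessel_p_series a"
  shows "fps_X * fps_deriv P + fps_const (of_real a + 1) * P = 1 + fps_X * P ^ 2"
proof -
  define B where "B = bessel_fps a"
  have BP: "B * P = - fps_deriv B"
    using inverse_mult_eq_1'[of B] by (simp add: P_def bessel_p_series_def B_def)
  hence "fps_deriv (B * P) = - fps_deriv (fps_deriv B)" by simp
  hence D: "fps_deriv (fps_deriv B) = - (fps_deriv B * P + B * fps_deriv P)" by (simp add: algebra_simps)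
  have D1: "fps_deriv B = - (B * P)" using BP by simp
  \<comment> \<open>Bessel's equation with \<open>B'\<close> and \<open>B''\<close> expressed by \<open>B\<close> and \<open>P\<close>; the factor \<open>B\<close> is then cancelled\<close>
  have "B * (fps_X * fps_deriv P + fps_const (of_real a + 1) * P - (1 + fps_X * P ^ 2)) = 0"
    using bessel_fps_ode[OF assms(1), folded B_def] unfolding D unfolding D1
    by (simp only: power2_eq_square) algebra
  moreover have "B \<noteq> 0" using bessel_fps_0[of a] unfolding B_def by (metis fps_zero_nth zero_neq_one)
  ultimately show ?thesis by simp
qed

text \<open>The Riccati equation determines the coefficients recursively,
  \<open>(n + a + 1) p\<^sub>n = [n = 0] + (\<Sum>i+j=n-1. p\<^sub>i p\<^sub>j)\<close>, with positive weights only. So the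
  positivity needs no knowledge about the zeros of \<open>\<phi>\<close>.\<close>

lemma nonneg_bessel_p_series:
  assumes "a > 0"
  shows "nonneg_fps (bessel_p_series a)"
proof -
  define P where "P = bessel_p_series a"
  note ric = bessel_p_series_riccati[OF assms, folded P_def]
  have "fps_nth P n \<in> \<real>\<^sub>\<ge>\<^sub>0" for n
  proof (induction n rule: less_induct)
    case (less n)
    have "fps_nth (fps_X * fps_deriv P + fps_const (of_real a + 1) * P) n
            = of_real (real n + a + 1) * fps_nth P n"
      by (cases n) (simp_all add: algebra_simps)
    hence eq: "of_real (real n + a + 1) * fps_nth P n = fps_nth (1 + fps_X * P ^ 2) n"
      using ric by simp
    have "fps_nth (1 + fps_X * P ^ 2) n \<in> \<real>\<^sub>\<ge>\<^sub>0"
    proof (cases n)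
      case (Suc m)
      have "fps_nth (P ^ 2) m \<in> \<real>\<^sub>\<ge>\<^sub>0"
        unfolding power2_eq_square fps_mult_nth
        by (intro nonneg_Reals_sum nonneg_Reals_mult_I less) (auto simp: Suc)
      with Suc show ?thesis by simp
    qed simp
    moreover have "fps_nth P n = of_real (inverse (real n + a + 1)) * fps_nth (1 + fps_X * P ^ 2) n"
      unfolding eq[symmetric] using assms
      by (simp only: mult.assoc[symmetric] of_real_mult[symmetric]) simp
    ultimately show ?case
      using assms by (metis nonneg_Reals_mult_I nonneg_Reals_of_real_iff inverse_nonnegative_iff_nonnegative
          add_nonneg_nonneg of_nat_0_le_iff less_imp_le zero_le_one)
  qed
  thus ?thesis by (simp add: nonneg_fps_def P_def)
qed

lemma bessel_p_series_0:
  assumes "a > 0"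
  shows "fps_nth (bessel_p_series a) 0 = of_real (1 / (a + 1))"
proof -
  have "fps_nth (fps_X * fps_deriv (bessel_p_series a) + fps_const (of_real a + 1) * bessel_p_series a) 0
    = fps_nth (1 + fps_X * (bessel_p_series a)\<^sup>2) 0"
    by (simp only: bessel_p_series_riccati[OF assms])
  hence "of_real (a + 1) * fps_nth (bessel_p_series a) 0 = 1"
    by simp
  moreover have "complex_of_real (a + 1) \<noteq> 0" using assms by (simp only: of_real_eq_0_iff)
  ultimately show ?thesis by (simp add: field_simps)
qed

section \<open>The logarithmic derivative on the disk without zeros\<close>

definition bessel_phi :: "real \<Rightarrow> complex \<Rightarrow> complex" where
  "bessel_phi a = eval_fps (bessel_fps a)"

definition bessel_p :: "real \<Rightarrow> complex \<Rightarrow> complex" where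
  "bessel_p a z = - deriv (bessel_phi a) z / bessel_phi a z"

lemma holomorphic_bessel_phi: "a > 0 \<Longrightarrow> bessel_phi a holomorphic_on S"
  unfolding bessel_phi_def by (intro holomorphic_intros) auto

lemma bessel_phi_0 [simp]: "bessel_phi a 0 = 1"
  by (simp add: bessel_phi_def eval_fps_at_0)

lemma has_field_derivative_bessel_phi:
  assumes "a > 0" "bessel_phi a z \<noteq> 0"
  shows "(bessel_phi a has_field_derivative - bessel_p a z * bessel_phi a z) (at z)"
proof -
  have "(bessel_phi a has_field_derivative deriv (bessel_phi a) z) (at z)"
    using holomorphic_bessel_phi[OF assms(1), of UNIV] by (intro holomorphic_derivI[of _ UNIV]) auto
  thus ?thesis using assms(2) by (simp add: bessel_p_def)
qed

lemma eval_bessel_p_series: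
  assumes a: "a > 0" and R: "R > 0" and nz: "\<And>z. z \<in> ball 0 R \<Longrightarrow> bessel_phi a z \<noteq> 0"
  shows "ereal R \<le> fps_conv_radius (bessel_p_series a)"
    and "\<And>z. z \<in> ball 0 R \<Longrightarrow> eval_fps (bessel_p_series a) z = bessel_p a z"
proof -
  let ?B = "bessel_fps a"
  have nz': "\<And>z. ereal (norm z) < ereal R \<Longrightarrow> eval_fps ?B z \<noteq> 0"
    using nz by (simp add: bessel_phi_def)
  have iR: "ereal R \<le> fps_conv_radius (inverse ?B)"
    using fps_conv_radius_inverse[of "ereal R" ?B, OF nz'] a by simp
  have dR: "fps_conv_radius (fps_deriv ?B) = \<infinity>"
    using fps_conv_radius_deriv[of ?B] a by simp
  have "ereal R \<le> min (fps_conv_radius (- fps_deriv ?B)) (fps_conv_radius (inverse ?B))"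
    using iR dR by simp
  thus "ereal R \<le> fps_conv_radius (bessel_p_series a)"
    unfolding bessel_p_series_def using fps_conv_radius_mult order_trans by blast
  fix z :: complex assume z: "z \<in> ball 0 R"
  have z': "ereal (norm z) < ereal R" using z by simp
  have "eval_fps (bessel_p_series a) z = - eval_fps (fps_deriv ?B) z * inverse (eval_fps ?B z)"
    unfolding bessel_p_series_def using less_le_trans[OF z' iR] dR a
      eval_fps_inverse[of "ereal R" ?B z, OF nz' _ z']
    by (subst eval_fps_mult) (auto simp: eval_fps_minus)
  also have "eval_fps (fps_deriv ?B) z = deriv (bessel_phi a) z"
    unfolding bessel_phi_def by (rule eval_fps_deriv) (simp add: a)
  finally show "eval_fps (bessel_p_series a) z = bessel_p a z"
    by (simp add: bessel_p_def bessel_phi_def divide_inverse)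
qed

lemma Re_bessel_p_ge:
  assumes a: "a > 0" and R: "R > 0" and nz: "\<And>z. z \<in> ball 0 R \<Longrightarrow> bessel_phi a z \<noteq> 0"
    and x: "0 \<le> x" "x < R"
  shows "1 / (a + 1) \<le> Re (bessel_p a (of_real x))"
proof -
  have "ereal x < fps_conv_radius (bessel_p_series a)"
    using eval_bessel_p_series(1)[OF a R nz] x by (meson ereal_less(2) less_ereal.simps(1) less_le_trans)
  from Re_eval_nonneg_fps_ge_coeff[OF nonneg_bessel_p_series[OF a] x(1) this]
  show ?thesis using eval_bessel_p_series(2)[OF a R nz, of "of_real x"] x
    by (simp add: bessel_p_series_0[OF a])
qed

lemma norm_bessel_p_le:
  assumes a: "a > 0" and R: "R > 0" and nz: "\<And>z. z \<in> ball 0 R \<Longrightarrow> bessel_phi a z \<noteq> 0"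
    and x: "norm z \<le> x" "x < R"
  shows "norm (bessel_p a z) \<le> Re (bessel_p a (of_real x))"
proof -
  have "0 \<le> x" using x norm_ge_zero order_trans by blast
  have "ereal x < fps_conv_radius (bessel_p_series a)"
    using eval_bessel_p_series(1)[OF a R nz] x by (meson less_ereal.simps(1) less_le_trans)
  from norm_eval_nonneg_fps_le[OF nonneg_bessel_p_series[OF a] x(1) this]
  show ?thesis using eval_bessel_p_series(2)[OF a R nz, of "of_real x"]
      eval_bessel_p_series(2)[OF a R nz, of z] x \<open>0 \<le> x\<close>
    by simp
qed

lemma has_field_derivative_log_branch:
  fixes f L :: "complex \<Rightarrow> complex"
  assumes "open S" "L holomorphic_on S" and L: "\<And>z. z \<in> S \<Longrightarrow> exp (L z) = f z" and z: "z \<in> S"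
    and f: "(f has_field_derivative D * f z) (at z)"
  shows "(L has_field_derivative D) (at z)"
proof -
  have d: "(L has_field_derivative deriv L z) (at z)"
    using assms by (intro holomorphic_derivI[of _ S]) auto
  have "((\<lambda>z. exp (L z)) has_field_derivative exp (L z) * deriv L z) (at z)"
    by (rule DERIV_fun_exp[OF d])
  moreover have "((\<lambda>z. exp (L z)) has_field_derivative D * f z) (at z)"
    using f by (rule has_field_derivative_transform_within_open[of _ _ _ S]) (use assms in auto)
  ultimately have "exp (L z) * deriv L z = D * exp (L z)"
    using DERIV_unique L[OF z] by metis
  hence "deriv L z = D" by simp
  with d show ?thesis by simp
qed

text \<open>If \<open>p\<close> were bounded by \<open>M\<close> on the radius, then by positivity of the coefficients it would be
  bounded by \<open>M\<close> on the disk. A branch \<open>L\<close> of \<open>log \<phi>\<close> has derivative \<open>-p\<close>, so it would stay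
  bounded too, and \<open>\<bar>\<phi>\<bar> = exp (Re L)\<close> would stay away from \<open>0\<close> up to the boundary, where \<open>z0\<close> is a
  zero.\<close>

lemma bessel_p_unbounded_near_first_zero:
  assumes a: "a > 0" and R: "R > 0" and nz: "\<And>z. z \<in> ball 0 R \<Longrightarrow> bessel_phi a z \<noteq> 0"
    and z0: "norm z0 = R" "bessel_phi a z0 = 0"
  shows "\<exists>x. 0 < x \<and> x < R \<and> M \<le> Re (bessel_p a (of_real x))"
proof (rule ccontr)
  assume "\<not> ?thesis"
  hence M: "Re (bessel_p a (of_real x)) < M" if "0 < x" "x < R" for x
    using that by force
  have pM: "norm (bessel_p a z) \<le> M" if "z \<in> ball 0 R" for z
  proof -
    \<comment> \<open>the assumed bound holds at positive points only, so the centre is compared with \<open>R / 2\<close>\<close>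
    have "norm (bessel_p a z) \<le> Re (bessel_p a (of_real (max (norm z) (R / 2))))"
      using that R by (intro norm_bessel_p_le[OF a R nz]) auto
    also have "\<dots> < M" using that R by (intro M) auto
    finally show ?thesis by simp
  qed
  have M0: "0 \<le> M" using order_trans[OF norm_ge_zero pM[of 0]] R by simp
  obtain L where L: "L holomorphic_on ball 0 R" "\<And>z. z \<in> ball 0 R \<Longrightarrow> bessel_phi a z = exp (L z)"
    using simply_connected_imp_holomorphic_log[OF holomorphic_bessel_phi[OF a] _ _ nz, of "ball 0 R"]
      convex_imp_simply_connected[of "ball (0::complex) R"]
      open_imp_locally_path_connected[of "ball (0::complex) R"] by (metis convex_ball open_ball)
  have dL: "(L has_field_derivative - bessel_p a z) (at z)" if z: "z \<in> ball 0 R" for z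
    using L(2) by (intro has_field_derivative_log_branch[OF open_ball L(1) _ z
        has_field_derivative_bessel_phi[OF a nz[OF z]]]) auto
  have low: "exp (Re (L 0) - M * R) \<le> norm (bessel_phi a z)" if z: "z \<in> ball 0 R" for z
  proof -
    have "norm (L z - L 0) \<le> M * norm (z - 0)"
      using z R pM
      by (intro field_differentiable_bound[of "ball 0 R" L "\<lambda>z. - bessel_p a z"])
         (auto intro!: has_field_derivative_at_within[OF dL])
    also have "\<dots> \<le> M * R" using z M0 by (intro mult_left_mono) auto
    finally have "Re (L 0) - M * R \<le> Re (L z)"
      using abs_Re_le_cmod[of "L z - L 0"] by simp
    thus ?thesis using L(2)[OF z] by (simp add: norm_exp_eq_Re)
  qed
  have "closed {z. exp (Re (L 0) - M * R) \<le> norm (bessel_phi a z)}"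
    by (intro closed_Collect_le continuous_intros
        holomorphic_on_imp_continuous_on[OF holomorphic_bessel_phi[OF a]])
  moreover have "ball 0 R \<subseteq> {z. exp (Re (L 0) - M * R) \<le> norm (bessel_phi a z)}" using low by auto
  ultimately have "closure (ball 0 R) \<subseteq> {z. exp (Re (L 0) - M * R) \<le> norm (bessel_phi a z)}"
    by (rule closure_minimal[rotated])
  moreover have "z0 \<in> closure (ball 0 R)" using z0 R by simp
  ultimately show False using z0 exp_gt_zero[of "Re (L 0) - M * R"] by force
qed

text \<open>If \<open>\<phi>\<close> has no zeros, \<open>p\<close> is defined on the whole positive axis and is at least its constant
  coefficient \<open>1 / (a + 1)\<close>. Otherwise \<open>p\<close> blows up at the modulus \<open>R\<close> of a zero closest to \<open>0\<close>.\<close>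

lemma bessel_p_times_argument_unbounded:
  assumes a: "a > 0"
  shows "\<exists>x R. 0 < x \<and> x < R \<and> (\<forall>z\<in>ball 0 R. bessel_phi a z \<noteq> 0) \<and> M \<le> x * Re (bessel_p a (of_real x))"
proof (cases "\<exists>z. bessel_phi a z = 0")
  case False
  define x where "x = (a + 1) * max M 1"
  have x: "0 < x" using a by (simp add: x_def)
  have "1 / (a + 1) \<le> Re (bessel_p a (of_real x))"
    using False x by (intro Re_bessel_p_ge[OF a, of "x + 1"]) auto
  hence "x * (1 / (a + 1)) \<le> x * Re (bessel_p a (of_real x))" using x by (intro mult_left_mono) auto
  moreover have "x * (1 / (a + 1)) = max M 1" using a by (simp add: x_def)
  ultimately show ?thesis using x False by (intro exI[of _ x] exI[of _ "x + 1"]) auto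
next
  case True
  let ?Z = "{z. bessel_phi a z = 0}"
  have "closed ?Z"
    by (intro closed_Collect_eq continuous_intros
        holomorphic_on_imp_continuous_on[OF holomorphic_bessel_phi[OF a]])
  then obtain z0 where z0: "z0 \<in> ?Z" "\<And>z. z \<in> ?Z \<Longrightarrow> dist 0 z0 \<le> dist 0 z"
    using distance_attains_inf[of ?Z 0] True by blast
  define R where "R = norm z0"
  have R: "R > 0" using z0(1) by (auto simp: R_def)
  have nz: "bessel_phi a z \<noteq> 0" if "z \<in> ball 0 R" for z
    using z0(2)[of z] that by (auto simp: R_def)
  obtain y where y: "0 < y" "y < R" "2 * max M 0 / R \<le> Re (bessel_p a (of_real y))"
    using bessel_p_unbounded_near_first_zero[OF a R nz R_def[symmetric]] z0(1) by blast
  \<comment> \<open>the factor \<open>x\<close> of \<open>x p(x)\<close> must not be small, so \<open>y\<close> is moved beyond \<open>R / 2\<close>; \<open>p\<close> increases\<close>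
  define x where "x = max y (R / 2)"
  have x: "R / 2 \<le> x" "x < R" "0 < x" using y R by (auto simp: x_def)
  have "Re (bessel_p a (of_real y)) \<le> norm (bessel_p a (of_real y))" by (rule complex_Re_le_cmod)
  also have "\<dots> \<le> Re (bessel_p a (of_real x))"
    using y x by (intro norm_bessel_p_le[OF a R nz]) (auto simp: x_def)
  finally have "(R / 2) * (2 * max M 0 / R) \<le> x * Re (bessel_p a (of_real x))"
    using y x R by (intro mult_mono) auto
  hence "M \<le> x * Re (bessel_p a (of_real x))" using R by auto
  with x nz show ?thesis by blast
qed

section \<open>The convexity series and its first root\<close>

text \<open>With \<open>\<psi> = \<gamma> u p\<close> this is \<open>m u (\<beta> p + \<psi>' / (1 - \<psi>))\<close>. It equals \<open>- z F''(z) / F'(z)\<close> at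
  \<open>u = q z\<^sup>m\<close> whenever \<open>F' = E (1 - \<psi>)\<close> and \<open>z E' / E = - m \<beta> u p\<close>; for a real power \<open>\<beta>\<close> the latter
  says that \<open>E = \<phi>(q z\<^sup>m)\<^bsup>\<beta>\<^esup>\<close> up to a constant factor.\<close>

definition convexity_series :: "real \<Rightarrow> nat \<Rightarrow> real \<Rightarrow> real \<Rightarrow> complex \<Rightarrow> complex" where
  "convexity_series a m \<beta> \<gamma> u =
     of_nat m * u * (of_real \<beta> * bessel_p a u +
        of_real \<gamma> * (bessel_p a u + u * deriv (bessel_p a) u) / (1 - of_real \<gamma> * u * bessel_p a u))"

lemma holomorphic_bessel_p:
  assumes "a > 0" "open S" "\<And>z. z \<in> S \<Longrightarrow> bessel_phi a z \<noteq> 0"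
  shows "bessel_p a holomorphic_on S"
  unfolding bessel_p_def using assms
  by (intro holomorphic_intros holomorphic_bessel_phi holomorphic_deriv) auto

text \<open>The series is built from \<open>p\<close> by sums, products, the derivative and \<open>\<psi> \<mapsto> 1 / (1 - \<psi>)\<close>, all of
  which preserve nonnegativity of the coefficients.\<close>

lemma convexity_series_fps:
  assumes a: "a > 0" and R: "R > 0" and \<beta>: "\<beta> \<ge> 0" and \<gamma>: "\<gamma> > 0"
    and nz: "\<And>z. z \<in> ball 0 R \<Longrightarrow> bessel_phi a z \<noteq> 0"
    and ne1: "\<And>z. z \<in> ball 0 R \<Longrightarrow> of_real \<gamma> * z * bessel_p a z \<noteq> 1"
  obtains F where "nonneg_fps F" "ereal R \<le> fps_conv_radius F"
    "\<And>z. z \<in> ball 0 R \<Longrightarrow> eval_fps F z = convexity_series a m \<beta> \<gamma> z"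
proof -
  define P where "P = bessel_p_series a"
  define \<Psi> where "\<Psi> = fps_const (of_real \<gamma>) * (fps_X * P)"
  define F where "F = fps_const (of_real (real m)) *
      (fps_X * (fps_const (of_real \<beta>) * P + fps_deriv \<Psi> * inverse (1 - \<Psi>)))"
  have P: "nonneg_fps P" unfolding P_def by (rule nonneg_bessel_p_series[OF a])
  have \<Psi>: "nonneg_fps \<Psi>" unfolding \<Psi>_def using \<gamma>
    by (intro nonneg_fps_mult nonneg_fps_const nonneg_fps_X P) auto
  have \<Psi>0: "fps_nth \<Psi> 0 = 0" by (simp add: \<Psi>_def)
  have F: "nonneg_fps F" unfolding F_def using \<beta>
    by (intro nonneg_fps_mult nonneg_fps_add nonneg_fps_const nonneg_fps_X P nonneg_fps_deriv
        nonneg_fps_inverse_one_minus \<Psi> \<Psi>0) auto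
  have PR: "ereal R \<le> fps_conv_radius P" unfolding P_def by (rule eval_bessel_p_series(1)[OF a R nz])
  have XPR: "ereal R \<le> fps_conv_radius (fps_X * P)"
    by (rule order_trans[OF _ fps_conv_radius_mult]) (use PR in simp)
  have \<Psi>R: "ereal R \<le> fps_conv_radius \<Psi>" unfolding \<Psi>_def
    by (rule order_trans[OF _ fps_conv_radius_mult]) (use XPR in simp)
  have \<Psi>1R: "ereal R \<le> fps_conv_radius (1 - \<Psi>)"
    by (rule order_trans[OF _ fps_conv_radius_diff]) (use \<Psi>R in simp)
  have \<Psi>'R: "ereal R \<le> fps_conv_radius (fps_deriv \<Psi>)"
    using \<Psi>R fps_conv_radius_deriv order_trans by blast
  have evP: "eval_fps P z = bessel_p a z" if "z \<in> ball 0 R" for z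
    unfolding P_def by (rule eval_bessel_p_series(2)[OF a R nz that])
  have r: "ereal (norm z) < fps_conv_radius G" if "z \<in> ball 0 R" "ereal R \<le> fps_conv_radius G"
    for z :: complex and G :: "complex fps"
    using that by (intro less_le_trans[OF _ that(2)]) simp
  have ev\<Psi>: "eval_fps \<Psi> z = of_real \<gamma> * z * bessel_p a z" if "z \<in> ball 0 R" for z
    unfolding \<Psi>_def using that by (simp add: eval_fps_mult evP r PR XPR)
  have ev\<Psi>1: "eval_fps (1 - \<Psi>) z = 1 - of_real \<gamma> * z * bessel_p a z" if "z \<in> ball 0 R" for z
    using that by (simp add: eval_fps_diff r \<Psi>R ev\<Psi>)
  have nz1: "\<And>z. ereal (norm z) < ereal R \<Longrightarrow> eval_fps (1 - \<Psi>) z \<noteq> 0"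
    using ne1 by (simp add: ev\<Psi>1)
  have iR: "ereal R \<le> fps_conv_radius (inverse (1 - \<Psi>))"
    by (rule order_trans[OF _ fps_conv_radius_inverse[of "ereal R", OF nz1]]) (use \<Psi>1R in auto)
  have evi: "eval_fps (inverse (1 - \<Psi>)) z = inverse (1 - of_real \<gamma> * z * bessel_p a z)"
    if z: "z \<in> ball 0 R" for z
    using eval_fps_inverse[of "ereal R" "1 - \<Psi>" z, OF nz1 r[OF z \<Psi>1R]] z by (simp add: ev\<Psi>1)
  have evd: "eval_fps (fps_deriv \<Psi>) z = of_real \<gamma> * (bessel_p a z + z * deriv (bessel_p a) z)"
    if z: "z \<in> ball 0 R" for z
  proof -
    have hol: "bessel_p a holomorphic_on ball 0 R" by (rule holomorphic_bessel_p[OF a _ nz]) auto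
    have "(bessel_p a has_field_derivative deriv (bessel_p a) z) (at z)"
      by (rule holomorphic_derivI[OF hol _ z]) auto
    hence "((\<lambda>z. of_real \<gamma> * z * bessel_p a z) has_field_derivative
             of_real \<gamma> * (bessel_p a z + z * deriv (bessel_p a) z)) (at z)"
      by (auto intro!: derivative_eq_intros simp: algebra_simps)
    hence "(eval_fps \<Psi> has_field_derivative
             of_real \<gamma> * (bessel_p a z + z * deriv (bessel_p a) z)) (at z)"
      by (rule has_field_derivative_transform_within_open[of _ _ _ "ball 0 R"]) (use z ev\<Psi> in auto)
    moreover have "(eval_fps \<Psi> has_field_derivative eval_fps (fps_deriv \<Psi>) z) (at z)"
      by (rule has_field_derivative_eval_fps[OF r[OF z \<Psi>R]])
    ultimately show ?thesis by (metis DERIV_unique)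
  qed
  define G1 where "G1 = fps_const (of_real \<beta>) * P"
  define G2 where "G2 = fps_deriv \<Psi> * inverse (1 - \<Psi>)"
  have G1R: "ereal R \<le> fps_conv_radius G1" unfolding G1_def
    by (rule order_trans[OF _ fps_conv_radius_mult]) (use PR in simp)
  have G2R: "ereal R \<le> fps_conv_radius G2" unfolding G2_def
    by (rule order_trans[OF _ fps_conv_radius_mult]) (use \<Psi>'R iR in simp)
  have G12R: "ereal R \<le> fps_conv_radius (G1 + G2)"
    by (rule order_trans[OF _ fps_conv_radius_add]) (use G1R G2R in simp)
  have XGR: "ereal R \<le> fps_conv_radius (fps_X * (G1 + G2))"
    by (rule order_trans[OF _ fps_conv_radius_mult]) (use G12R in simp)
  have FR: "ereal R \<le> fps_conv_radius F" unfolding F_def G1_def[symmetric] G2_def[symmetric]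
    by (rule order_trans[OF _ fps_conv_radius_mult]) (use XGR in simp)
  show ?thesis
  proof (rule that[OF F FR])
    fix z :: complex assume z: "z \<in> ball 0 R"
    have "eval_fps G1 z = of_real \<beta> * bessel_p a z"
      unfolding G1_def using z by (simp add: eval_fps_mult r PR evP)
    moreover have "eval_fps G2 z =
        of_real \<gamma> * (bessel_p a z + z * deriv (bessel_p a) z) / (1 - of_real \<gamma> * z * bessel_p a z)"
      unfolding G2_def using z by (simp add: eval_fps_mult r \<Psi>'R iR evd evi divide_inverse)
    ultimately show "eval_fps F z = convexity_series a m \<beta> \<gamma> z"
      unfolding F_def G1_def[symmetric] G2_def[symmetric] using z
      by (simp add: eval_fps_mult eval_fps_add r G1R G2R G12R XGR convexity_series_def)
  qed
qed

lemma bessel_p_of_real: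
  assumes a: "a > 0" and R: "R > 0" and nz: "\<And>z. z \<in> ball 0 R \<Longrightarrow> bessel_phi a z \<noteq> 0"
    and x: "0 \<le> x" "x < R"
  shows "deriv (bessel_p a) (of_real x) = of_real (Re (deriv (bessel_p a) (of_real x)))"
    and "0 \<le> Re (deriv (bessel_p a) (of_real x))"
    and "bessel_p a (of_real x) = of_real (Re (bessel_p a (of_real x)))"
proof -
  define P where "P = bessel_p_series a"
  have P: "nonneg_fps P" unfolding P_def by (rule nonneg_bessel_p_series[OF a])
  have PR: "ereal R \<le> fps_conv_radius P" unfolding P_def by (rule eval_bessel_p_series(1)[OF a R nz])
  have xP: "ereal x < fps_conv_radius P" using x by (intro less_le_trans[OF _ PR]) simp
  have xD: "ereal x < fps_conv_radius (fps_deriv P)"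
    by (rule less_le_trans[OF xP fps_conv_radius_deriv])
  have "(eval_fps P has_field_derivative eval_fps (fps_deriv P) (of_real x)) (at (of_real x))"
    using x xP by (intro has_field_derivative_eval_fps) auto
  hence "(bessel_p a has_field_derivative eval_fps (fps_deriv P) (of_real x)) (at (of_real x))"
    by (rule has_field_derivative_transform_within_open[of _ _ _ "ball 0 R"])
       (use x eval_bessel_p_series(2)[OF a R nz] P_def in auto)
  hence d: "deriv (bessel_p a) (of_real x) = eval_fps (fps_deriv P) (of_real x)"
    by (rule DERIV_imp_deriv)
  show "deriv (bessel_p a) (of_real x) = of_real (Re (deriv (bessel_p a) (of_real x)))"
    unfolding d by (rule eval_nonneg_fps_eq_Re[OF nonneg_fps_deriv[OF P] x(1) xD])
  show "0 \<le> Re (deriv (bessel_p a) (of_real x))"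
    unfolding d by (rule Re_eval_nonneg_fps_ge_0[OF nonneg_fps_deriv[OF P] x(1) xD])
  have "eval_fps P (of_real x) = bessel_p a (of_real x)"
    unfolding P_def by (rule eval_bessel_p_series(2)[OF a R nz]) (use x in auto)
  thus "bessel_p a (of_real x) = of_real (Re (bessel_p a (of_real x)))"
    using eval_nonneg_fps_eq_Re[OF P x(1) xP] by metis
qed

text \<open>Take for \<open>u\<close> the least point of the positive axis where the value \<open>T\<close> is reached. Below \<open>u\<close> the
  real values are less than \<open>T\<close>, and the positivity of the coefficients carries this over to the
  disk of radius \<open>u\<close>.\<close>

lemma exists_root_nonneg_fps:
  assumes F: "nonneg_fps F" and F0: "fps_nth F 0 = 0" and y: "0 \<le> y" "ereal y < fps_conv_radius F"
    and T: "0 < T" "T \<le> Re (eval_fps F (of_real y))"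
  shows "\<exists>u. 0 < u \<and> u \<le> y \<and> eval_fps F (of_real u) = of_real T \<and>
             (\<forall>z\<in>ball 0 u. Re (eval_fps F z) < T)"
proof -
  define h where "h t = Re (eval_fps F (of_real t))" for t
  have rad: "ereal t < fps_conv_radius F" if "t \<le> y" for t
    using that y(2) by (meson ereal_less_eq(3) order.strict_trans1)
  have cont: "continuous_on {0..y} h" unfolding h_def
    by (intro continuous_intros) (auto intro: rad)
  have h0: "h 0 = 0" by (simp add: h_def eval_fps_at_0 F0)
  define S where "S = {t \<in> {0..y}. T \<le> h t}"
  have "closed S" unfolding S_def
    by (intro continuous_on_closed_Collect_le cont continuous_on_const) auto
  moreover have "bounded S" by (rule bounded_subset[of "{0..y}"]) (auto simp: S_def)
  ultimately have "compact S" by (simp add: compact_eq_bounded_closed)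
  moreover have "y \<in> S" using y T by (auto simp: S_def h_def)
  ultimately obtain u where u: "u \<in> S" "\<And>t. t \<in> S \<Longrightarrow> u \<le> t"
    using compact_attains_inf[of S] by blast
  have uy: "0 \<le> u" "u \<le> y" "T \<le> h u" using u(1) by (auto simp: S_def)
  have u0: "0 < u" using uy h0 T by (cases "u = 0") auto
  have "\<exists>t\<ge>0. t \<le> u \<and> h t = T"
    using uy h0 T by (intro IVT' continuous_on_subset[OF cont]) auto
  then obtain t where t: "0 \<le> t" "t \<le> u" "h t = T" by blast
  hence "t \<in> S" using uy by (auto simp: S_def)
  with t u have hu: "h u = T" by force
  have "eval_fps F (of_real u) = of_real T"
    using eval_nonneg_fps_eq_Re[OF F uy(1) rad[OF uy(2)]] hu by (simp add: h_def)
  moreover have "Re (eval_fps F z) < T" if z: "z \<in> ball 0 u" for z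
  proof -
    have "Re (eval_fps F z) \<le> norm (eval_fps F z)" by (rule complex_Re_le_cmod)
    also have "\<dots> \<le> h (norm z)" unfolding h_def
      using z uy by (intro norm_eval_nonneg_fps_le[OF F] rad) auto
    also have "\<dots> < T" using u(2)[of "norm z"] z uy by (force simp: S_def)
    finally show ?thesis .
  qed
  ultimately show ?thesis using u0 uy by blast
qed

text \<open>On the positive axis \<open>\<psi> = \<gamma> u p\<close> runs from \<open>0\<close> through \<open>1/2\<close>, at \<open>y\<close>, to \<open>3/4\<close>, at \<open>R\<close>. On the disk
  of radius \<open>R\<close> therefore \<open>\<bar>\<psi>\<bar> \<le> 3/4\<close>. Since \<open>u \<psi>' \<ge> \<psi>\<close> on the positive axis, the series is at least
  \<open>\<psi> / (1 - \<psi>)\<close> there, which is \<open>1\<close> at \<open>y\<close>; so every value \<open>T \<le> 1\<close> is reached in \<open>(0, y]\<close>.\<close>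

lemma exists_convexity_root:
  assumes a: "a > 0" and m: "m \<ge> 1" and \<beta>: "\<beta> \<ge> 0" and \<gamma>: "\<gamma> > 0" and T: "0 < T" "T \<le> 1"
  obtains u R where "0 < u" "u < R"
    "\<And>z. z \<in> ball 0 R \<Longrightarrow> bessel_phi a z \<noteq> 0"
    "\<And>z. z \<in> ball 0 R \<Longrightarrow> of_real \<gamma> * z * bessel_p a z \<noteq> 1"
    "convexity_series a m \<beta> \<gamma> (of_real u) = of_real T"
    "\<And>z. z \<in> ball 0 u \<Longrightarrow> Re (convexity_series a m \<beta> \<gamma> z) < T"
proof -
  define s where "s t = \<gamma> * t * Re (bessel_p a (of_real t))" for t
  obtain x R' where x: "0 < x" "x < R'" and nz': "\<And>z. z \<in> ball 0 R' \<Longrightarrow> bessel_phi a z \<noteq> 0"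
    and big: "3 / (4 * \<gamma>) \<le> x * Re (bessel_p a (of_real x))"
    using bessel_p_times_argument_unbounded[OF a, of "3 / (4 * \<gamma>)"] by blast
  have R': "R' > 0" using x by simp
  have hol: "bessel_p a holomorphic_on ball 0 R'" by (rule holomorphic_bessel_p[OF a _ nz']) auto
  have "continuous_on {0..x} s" unfolding s_def
    by (intro continuous_intros continuous_on_compose2[OF holomorphic_on_imp_continuous_on[OF hol]])
       (use x in auto)
  note cont = this
  have s0: "s 0 = 0" by (simp add: s_def)
  have "\<gamma> * (3 / (4 * \<gamma>)) \<le> \<gamma> * (x * Re (bessel_p a (of_real x)))"
    using big \<gamma> by (intro mult_left_mono) auto
  hence sx: "3 / 4 \<le> s x" using \<gamma> by (simp add: s_def mult.assoc)
  have "\<exists>t\<ge>0. t \<le> x \<and> s t = 3 / 4"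
    using s0 sx x by (intro IVT' cont) auto
  then obtain R where R: "0 \<le> R" "R \<le> x" "s R = 3 / 4" by blast
  have "\<exists>t\<ge>0. t \<le> R \<and> s t = 1 / 2"
    using s0 R by (intro IVT' continuous_on_subset[OF cont]) auto
  then obtain y where y: "0 \<le> y" "y \<le> R" "s y = 1 / 2" by blast
  have yR: "y < R" using y R by (cases "y = R") auto
  have y0: "0 < y" using y s0 by (cases "y = 0") auto
  have R0: "0 < R" using yR y by simp
  have nz: "bessel_phi a z \<noteq> 0" if "z \<in> ball 0 R" for z using that R x by (intro nz') auto
  have le: "norm (of_real \<gamma> * z * bessel_p a z) \<le> 3 / 4" if z: "z \<in> ball 0 R" for z
  proof -
    have "norm (of_real \<gamma> * z * bessel_p a z) = \<gamma> * norm z * norm (bessel_p a z)"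
      using \<gamma> by (simp add: norm_mult)
    also have "\<dots> \<le> \<gamma> * R * Re (bessel_p a (of_real R))"
      using z R x \<gamma> by (intro mult_mono norm_bessel_p_le[OF a R' nz']) auto
    also have "\<dots> = 3 / 4" using R by (simp add: s_def)
    finally show ?thesis .
  qed
  have ne1: "of_real \<gamma> * z * bessel_p a z \<noteq> 1" if "z \<in> ball 0 R" for z
  proof
    assume "of_real \<gamma> * z * bessel_p a z = 1"
    with le[OF that] have "norm (1 :: complex) \<le> 3 / 4" by metis
    thus False by simp
  qed
  obtain F where F: "nonneg_fps F" "ereal R \<le> fps_conv_radius F"
    "\<And>z. z \<in> ball 0 R \<Longrightarrow> eval_fps F z = convexity_series a m \<beta> \<gamma> z"
    using convexity_series_fps[OF a R0 \<beta> \<gamma> nz ne1, of m] by blast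
  have F0: "fps_nth F 0 = 0"
    using F(3)[of 0] R0 by (simp add: eval_fps_at_0 convexity_series_def)
  define p p' where "p = Re (bessel_p a (of_real y))" and "p' = Re (deriv (bessel_p a) (of_real y))"
  have yd: "deriv (bessel_p a) (of_real y) = of_real p'" "0 \<le> p'" "bessel_p a (of_real y) = of_real p"
    using bessel_p_of_real[OF a R0 nz y(1) yR] unfolding p_def p'_def by blast+
  have "0 \<le> 1 / (a + 1)" using a by simp
  also have "\<dots> \<le> p" unfolding p_def by (rule Re_bessel_p_ge[OF a R0 nz y(1) yR])
  finally have p0: "0 \<le> p" .
  have "convexity_series a m \<beta> \<gamma> (of_real y) =
     of_real (real m * y * (\<beta> * p + \<gamma> * (p + y * p') / (1 - \<gamma> * y * p)))"
    unfolding convexity_series_def yd by simp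
  also have "1 - \<gamma> * y * p = 1 / 2" using y by (simp add: s_def p_def)
  finally have "Re (eval_fps F (of_real y)) = real m * y * (\<beta> * p + \<gamma> * (p + y * p') / (1 / 2))"
    using F(3)[of "of_real y"] y yR by simp
  moreover have "1 \<le> real m * y * (\<beta> * p + \<gamma> * (p + y * p') / (1 / 2))"
  proof -
    \<comment> \<open>\<open>\<gamma> y p = \<psi>(y) = 1/2\<close>; dropping \<open>\<beta> p\<close> and \<open>p'\<close> only decreases the value\<close>
    have "1 = 1 * (\<gamma> * y * p * 2)" using y by (simp add: s_def p_def)
    also have "\<dots> \<le> real m * (\<gamma> * y * p * 2)" using m \<gamma> y p0 by (intro mult_right_mono) auto
    also have "\<dots> = real m * y * (\<gamma> * p / (1 / 2))" by simp
    also have "\<dots> \<le> real m * y * (\<beta> * p + \<gamma> * (p + y * p') / (1 / 2))"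
      using y \<gamma> \<beta> p0 yd(2) by (intro mult_left_mono) (auto simp: algebra_simps)
    finally show ?thesis .
  qed
  ultimately have "T \<le> Re (eval_fps F (of_real y))" using T by simp
  moreover have yF: "ereal y < fps_conv_radius F" using yR by (intro less_le_trans[OF _ F(2)]) simp
  ultimately obtain u where u: "0 < u" "u \<le> y" "eval_fps F (of_real u) = of_real T"
      "\<And>z. z \<in> ball 0 u \<Longrightarrow> Re (eval_fps F z) < T"
    using exists_root_nonneg_fps[OF F(1) F0 y(1) yF T(1)] by blast
  show ?thesis
  proof (rule that[of u R])
    show "convexity_series a m \<beta> \<gamma> (of_real u) = of_real T"
      using u yR F(3)[of "of_real u"] by simp
    show "\<And>z. z \<in> ball 0 u \<Longrightarrow> Re (convexity_series a m \<beta> \<gamma> z) < T"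
      using u yR F(3) by force
  qed (use u yR nz ne1 in auto)
qed

section \<open>From the first root to the radius of convexity\<close>

text \<open>At the point \<open>r\<close> itself the real part equals \<open>\<alpha>\<close>, so no larger disk is admissible. The number
  \<open>\<rho>\<close> provides the room needed beyond \<open>r\<close>: on its disk the sum of the Taylor series agrees with \<open>F\<close>.\<close>

lemma radius_of_convexity_eqI:
  assumes F: "F holomorphic_on ball 0 \<rho>" and r: "0 < r" "r < \<rho>"
    and D: "\<And>z. z \<in> ball 0 \<rho> \<Longrightarrow> deriv F z \<noteq> 0"
    and K: "\<And>z. z \<in> ball 0 \<rho> \<Longrightarrow> 1 + z * deriv (deriv F) z / deriv F z = 1 - \<kappa> z"
    and root: "\<kappa> (of_real r) = of_real (1 - \<alpha>)"
    and less: "\<And>z. z \<in> ball 0 r \<Longrightarrow> Re (\<kappa> z) < 1 - \<alpha>"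
  shows "radius_of_convexity \<alpha> F = ereal r"
proof -
  define G where "G = eval_fps (fps_expansion F 0)"
  have F': "F holomorphic_on eball 0 (ereal \<rho>)" using F by simp
  have rad: "ereal \<rho> \<le> fps_conv_radius (fps_expansion F 0)"
    by (rule conv_radius_fps_expansion[OF F'])
  have GF: "G z = F z" if "z \<in> ball 0 \<rho>" for z
    using eval_fps_expansion'[OF F', of z] that by (simp add: G_def)
  have dG: "deriv G z = deriv F z" if "z \<in> ball 0 \<rho>" for z
    using GF by (intro deriv_cong_ev eventually_mono[OF eventually_nhds_in_open[OF open_ball that]]) auto
  have ddG: "deriv (deriv G) z = deriv (deriv F) z" if "z \<in> ball 0 \<rho>" for z
    using dG by (intro deriv_cong_ev[of "deriv G"]
        eventually_mono[OF eventually_nhds_in_open[OF open_ball that]]) auto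
  define A where "A = {s. 0 < s \<and> ereal s \<le> fps_conv_radius (fps_expansion F 0) \<and>
             (\<forall>z\<in>ball 0 s. deriv G z \<noteq> 0 \<and> Re (1 + z * deriv (deriv G) z / deriv G z) > \<alpha>)}"
  have "radius_of_convexity \<alpha> F = Sup (ereal ` A)"
    unfolding radius_of_convexity_def A_def G_def Let_def ..
  also have "\<dots> = ereal r"
  proof (rule cSup_eq_maximum)
    have "ereal r \<le> fps_conv_radius (fps_expansion F 0)"
      using r by (intro order_trans[OF _ rad]) simp
    moreover have "deriv G z \<noteq> 0 \<and> Re (1 + z * deriv (deriv G) z / deriv G z) > \<alpha>"
      if z: "z \<in> ball 0 r" for z
    proof -
      have z': "z \<in> ball 0 \<rho>" using z r by auto
      show ?thesis unfolding dG[OF z'] ddG[OF z'] K[OF z'] using D[OF z'] less[OF z] by simp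
    qed
    ultimately show "ereal r \<in> ereal ` A" using r by (auto simp: A_def)
  next
    fix e assume "e \<in> ereal ` A"
    then obtain s where s: "e = ereal s" "s \<in> A" by auto
    have "\<not> r < s"
    proof
      assume "r < s"
      hence "\<alpha> < Re (1 + of_real r * deriv (deriv G) (of_real r) / deriv G (of_real r))"
        using s(2) r by (auto simp: A_def)
      moreover have r': "complex_of_real r \<in> ball 0 \<rho>" using r by simp
      ultimately show False unfolding dG[OF r'] ddG[OF r'] K[OF r'] root by simp
    qed
    thus "e \<le> ereal r" using s by simp
  qed
  finally show ?thesis .
qed

text \<open>An equation \<open>P\<close> that is equivalent to \<open>1 - \<kappa>(s) = \<alpha>\<close> only for \<open>s < \<rho>\<close> suffices, since solutions
  beyond \<open>r\<close> cannot compete for being the smallest.\<close>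

lemma smallest_convexity_root:
  fixes \<kappa> :: "complex \<Rightarrow> complex"
  assumes r: "0 < r" "r < \<rho>"
    and P: "\<And>s. 0 < s \<Longrightarrow> s < \<rho> \<Longrightarrow> P s \<longleftrightarrow> 1 - \<kappa> (of_real s) = of_real \<alpha>"
    and root: "\<kappa> (of_real r) = complex_of_real (1 - \<alpha>)"
    and less: "\<And>z. z \<in> ball 0 r \<Longrightarrow> Re (\<kappa> z) < 1 - \<alpha>"
  shows "is_smallest_pos P r"
  unfolding is_smallest_pos_def
proof (intro conjI allI impI)
  show "P r" using P[of r] r root by simp
  fix s assume s: "0 < s \<and> P s"
  show "r \<le> s"
  proof (rule ccontr)
    assume "\<not> r \<le> s"
    hence sr: "s < r" by simp
    hence "1 - \<kappa> (of_real s) = of_real \<alpha>" using s P[of s] r by simp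
    hence "Re (1 - \<kappa> (of_real s)) = \<alpha>" by simp
    moreover have "Re (\<kappa> (of_real s)) < 1 - \<alpha>" using s sr by (intro less) auto
    ultimately show False by simp
  qed
qed (rule r)

text \<open>Logarithmic differentiation of \<open>F' = E (1 - \<psi>(q z\<^sup>m))\<close>, where \<open>e\<close> stands for \<open>z E' / E\<close>. Leaving
  \<open>e\<close> free covers the normalized functions and \<open>W\<close> itself, for which \<open>E = a W / z\<close>.\<close>

lemma log_derivative_of_deriv:
  fixes F E :: "complex \<Rightarrow> complex"
  assumes a: "a > 0" and m: "m \<ge> 1" and S: "open S" "z \<in> S"
    and nz: "\<And>z. z \<in> S \<Longrightarrow> bessel_phi a (of_real q * z ^ m) \<noteq> 0"
    and ne1: "\<And>z. z \<in> S \<Longrightarrow> of_real \<gamma> * (of_real q * z ^ m) * bessel_p a (of_real q * z ^ m) \<noteq> 1"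
    and dF: "\<And>z. z \<in> S \<Longrightarrow>
        deriv F z = E z * (1 - of_real \<gamma> * (of_real q * z ^ m) * bessel_p a (of_real q * z ^ m))"
    and E: "E z \<noteq> 0" "(E has_field_derivative E') (at z)"
      "z * E' = e * E z"
  shows "deriv F z \<noteq> 0"
    and "z * deriv (deriv F) z / deriv F z = e - of_nat m * (of_real q * z ^ m) *
      (of_real \<gamma> * (bessel_p a (of_real q * z ^ m) + (of_real q * z ^ m) *
        deriv (bessel_p a) (of_real q * z ^ m))
        / (1 - of_real \<gamma> * (of_real q * z ^ m) * bessel_p a (of_real q * z ^ m)))"
proof -
  define u where "u z = complex_of_real q * z ^ m" for z
  define X where "X z = 1 - of_real \<gamma> * u z * bessel_p a (u z)" for z
  have X: "X z \<noteq> 0" using ne1[OF S(2)] by (simp add: X_def u_def)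
  show nz': "deriv F z \<noteq> 0" using dF[OF S(2)] E(1) X by (simp add: X_def u_def)
  have du: "(u has_field_derivative of_real q * (of_nat m * z ^ (m - 1))) (at z)"
    unfolding u_def by (auto intro!: derivative_eq_intros)
  have zu: "z * (of_real q * (of_nat m * z ^ (m - 1))) = of_nat m * u z"
    using m by (cases m) (auto simp: u_def)
  define N where "N = - {w. bessel_phi a w = 0}"
  have "open N" unfolding N_def
    by (intro open_Compl closed_Collect_eq continuous_intros
        holomorphic_on_imp_continuous_on[OF holomorphic_bessel_phi[OF a]])
  have "bessel_p a holomorphic_on N" using \<open>open N\<close>
    by (intro holomorphic_bessel_p[OF a]) (auto simp: N_def)
  hence "(bessel_p a has_field_derivative deriv (bessel_p a) (u z)) (at (u z))"
    using \<open>open N\<close> nz[OF S(2)] by (intro holomorphic_derivI[of _ N]) (auto simp: N_def u_def)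
  hence dp: "((\<lambda>z. bessel_p a (u z)) has_field_derivative
      deriv (bessel_p a) (u z) * (of_real q * (of_nat m * z ^ (m - 1)))) (at z)"
    using du by (rule DERIV_chain2)
  define du' where "du' = of_real q * (of_nat m * z ^ (m - 1))"
  have dX: "(X has_field_derivative
      - (of_real \<gamma> * (bessel_p a (u z) + u z * deriv (bessel_p a) (u z)) * du')) (at z)"
    unfolding X_def using du dp unfolding du'_def[symmetric]
    by (auto intro!: derivative_eq_intros simp: algebra_simps)
  have "((\<lambda>z. E z * X z) has_field_derivative
      (E' * X z - E z * (of_real \<gamma> * (bessel_p a (u z) + u z * deriv (bessel_p a) (u z)) * du'))) (at z)"
    using E(2) dX by (auto intro!: derivative_eq_intros simp: algebra_simps)
  hence "(deriv F has_field_derivative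
      (E' * X z - E z * (of_real \<gamma> * (bessel_p a (u z) + u z * deriv (bessel_p a) (u z)) * du'))) (at z)"
    by (rule has_field_derivative_transform_within_open[of _ _ _ S])
       (use S dF in \<open>auto simp: X_def u_def\<close>)
  hence ddF: "deriv (deriv F) z =
      E' * X z - E z * (of_real \<gamma> * (bessel_p a (u z) + u z * deriv (bessel_p a) (u z)) * du')"
    by (rule DERIV_imp_deriv)
  have "z * deriv (deriv F) z = (z * E') * X z
      - E z * (of_real \<gamma> * (bessel_p a (u z) + u z * deriv (bessel_p a) (u z)) * (z * du'))"
    unfolding ddF by (simp add: algebra_simps)
  also have "z * du' = of_nat m * u z" using zu by (simp add: du'_def)
  also have "z * E' = e * E z" by (rule E(3))
  finally have eq: "z * deriv (deriv F) z = (e * X z - of_nat m * u z *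
      (of_real \<gamma> * (bessel_p a (u z) + u z * deriv (bessel_p a) (u z)))) * E z"
    by (simp only: ring_distribs mult_ac)
  have "deriv F z = E z * X z" using dF[OF S(2)] by (simp add: X_def u_def)
  hence "z * deriv (deriv F) z / deriv F z = (e * X z - of_nat m * u z *
      (of_real \<gamma> * (bessel_p a (u z) + u z * deriv (bessel_p a) (u z)))) / X z"
    unfolding eq using E(1) X by simp
  also have "\<dots> = e - of_nat m * u z *
      (of_real \<gamma> * (bessel_p a (u z) + u z * deriv (bessel_p a) (u z)) / X z)"
    using X by (simp add: diff_divide_distrib)
  finally show "z * deriv (deriv F) z / deriv F z = e - of_nat m * (of_real q * z ^ m) *
      (of_real \<gamma> * (bessel_p a (of_real q * z ^ m) + (of_real q * z ^ m) *
        deriv (bessel_p a) (of_real q * z ^ m))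
        / (1 - of_real \<gamma> * (of_real q * z ^ m) * bessel_p a (of_real q * z ^ m)))"
    unfolding X_def u_def .
qed

text \<open>The root found in the variable \<open>u\<close> is transported to \<open>z\<close> along \<open>u = q z\<^sup>m\<close>.\<close>

lemma exists_convexity_radius:
  assumes a: "a > 0" and m: "m \<ge> 1" and \<beta>: "\<beta> \<ge> 0" and \<gamma>: "\<gamma> > 0" and \<alpha>: "0 \<le> \<alpha>" "\<alpha> < 1" and q: "q > 0"
  obtains r \<rho> where "0 < r" "r < \<rho>"
    "\<And>z. z \<in> ball 0 \<rho> \<Longrightarrow> bessel_phi a (of_real q * z ^ m) \<noteq> 0"
    "\<And>z. z \<in> ball 0 \<rho> \<Longrightarrow> of_real \<gamma> * (of_real q * z ^ m) * bessel_p a (of_real q * z ^ m) \<noteq> 1"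
    "convexity_series a m \<beta> \<gamma> (of_real q * of_real r ^ m) = of_real (1 - \<alpha>)"
    "\<And>z. z \<in> ball 0 r \<Longrightarrow> Re (convexity_series a m \<beta> \<gamma> (of_real q * z ^ m)) < 1 - \<alpha>"
proof -
  have T: "0 < 1 - \<alpha>" "1 - \<alpha> \<le> 1" using \<alpha> by auto
  obtain u R where uR: "0 < u" "u < R"
    "\<And>z. z \<in> ball 0 R \<Longrightarrow> bessel_phi a z \<noteq> 0"
    "\<And>z. z \<in> ball 0 R \<Longrightarrow> of_real \<gamma> * z * bessel_p a z \<noteq> 1"
    "convexity_series a m \<beta> \<gamma> (of_real u) = of_real (1 - \<alpha>)"
    "\<And>z. z \<in> ball 0 u \<Longrightarrow> Re (convexity_series a m \<beta> \<gamma> z) < 1 - \<alpha>"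
    using exists_convexity_root[OF a m \<beta> \<gamma> T] by blast
  have m0: "0 < m" using m by simp
  define r \<rho> where "r = root m (u / q)" and "\<rho> = root m (R / q)"
  have pw: "q * r ^ m = u" "q * \<rho> ^ m = R"
    using uR q m0 by (auto simp: r_def \<rho>_def)
  have r: "0 < r" "r < \<rho>" using uR q m0 by (auto simp: r_def \<rho>_def divide_strict_right_mono)
  have in_ball: "of_real q * z ^ m \<in> ball 0 (q * t ^ m)" if "z \<in> ball 0 t" for z :: complex and t
    using that q m0 by (auto simp: norm_mult norm_power intro!: power_strict_mono)
  show ?thesis
  proof (rule that[OF r])
    show "convexity_series a m \<beta> \<gamma> (of_real q * of_real r ^ m) = of_real (1 - \<alpha>)"
      using uR(5) pw(1) by (metis of_real_mult of_real_power)
    fix z :: complex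
    show "bessel_phi a (of_real q * z ^ m) \<noteq> 0"
      and "of_real \<gamma> * (of_real q * z ^ m) * bessel_p a (of_real q * z ^ m) \<noteq> 1" if "z \<in> ball 0 \<rho>"
      using uR(3,4) in_ball[OF that] unfolding pw by blast+
    show "Re (convexity_series a m \<beta> \<gamma> (of_real q * z ^ m)) < 1 - \<alpha>" if "z \<in> ball 0 r"
      using uR(6) in_ball[OF that] unfolding pw by blast
  qed
qed

section \<open>The k-gamma function\<close>

text \<open>The change of variables below lives on \<open>(0, \<infinity>)\<close>, where \<open>t\<^sup>k\<close> is differentiable.\<close>

lemma has_integral_Ici_iff_Ioi:
  fixes f :: "real \<Rightarrow> 'a :: banach"
  shows "(f has_integral y) {b..} \<longleftrightarrow> (f has_integral y) {b<..}"
  by (rule has_integral_spike_set_eq; rule negligible_subset[of "{b}"]) auto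

text \<open>The substitution \<open>s = t\<^sup>k / k\<close> in Euler's integral.\<close>

lemma k_Gamma_integral_real:
  fixes k x :: real
  assumes k: "k > 0" and x: "x > 0"
  shows "((\<lambda>t. t powr (x - 1) * exp (- (t powr k) / k)) has_integral
     k powr (x / k - 1) * Gamma (x / k)) {0..}"
proof -
  define y where "y = x / k"
  have y: "y > 0" using assms by (simp add: y_def)
  define f where "f s = s powr (y - 1) / exp s" for s :: real
  define g where "g t = t powr k / k" for t :: real
  have "(f has_integral Gamma y) {0..}" unfolding f_def by (rule Gamma_integral_real[OF y])
  hence "(f has_integral Gamma y) {0<..}"
    by (simp only: has_integral_Ici_iff_Ioi)
  moreover from this have "f absolutely_integrable_on {0<..}"
    by (intro nonnegative_absolutely_integrable_1) (auto simp: f_def integrable_on_def)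
  moreover have img: "g ` {0<..} = {0<..}"
  proof (intro equalityI subsetI)
    fix t :: real assume "t \<in> {0<..}"
    thus "t \<in> g ` {0<..}" using k
      by (intro image_eqI[of _ _ "(k * t) powr (1 / k)"]) (auto simp: g_def powr_powr)
  qed (use k in \<open>auto simp: g_def\<close>)
  moreover have inj: "inj_on g {0<..}"
  proof (rule inj_onI)
    fix s t assume st: "s \<in> {0<..}" "t \<in> {0<..}" "g s = g t"
    hence "(s powr k) powr (1 / k) = (t powr k) powr (1 / k)" using k by (simp add: g_def)
    thus "s = t" using st k by (simp add: powr_powr)
  qed
  moreover have der: "(g has_field_derivative t powr (k - 1)) (at t within {0<..})" if "t \<in> {0<..}" for t
  proof -
    have "((\<lambda>t. t powr k / k) has_real_derivative k * t powr (k - 1) / k) (at t)"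
      using that by (intro DERIV_cdivide has_real_derivative_powr) auto
    hence "(g has_real_derivative t powr (k - 1)) (at t)" using k unfolding g_def by simp
    thus ?thesis by (rule has_field_derivative_at_within)
  qed
  ultimately have *: "(\<lambda>t. \<bar>t powr (k - 1)\<bar> * f (g t)) absolutely_integrable_on {0<..} \<and>
      integral {0<..} (\<lambda>t. \<bar>t powr (k - 1)\<bar> * f (g t)) = Gamma y"
    using has_absolute_integral_change_of_variables_1'[of "{0<..}" g "\<lambda>t. t powr (k - 1)" f "Gamma y"]
    by (simp add: integral_unique)
  hence "((\<lambda>t. \<bar>t powr (k - 1)\<bar> * f (g t)) has_integral Gamma y) {0<..}"
    by (metis has_integral_iff set_lebesgue_integral_eq_integral(1))
  hence "((\<lambda>t. k powr (y - 1) * (\<bar>t powr (k - 1)\<bar> * f (g t))) has_integral k powr (y - 1) * Gamma y) {0<..}"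
    by (rule has_integral_mult_right)
  moreover have "k powr (y - 1) * (\<bar>t powr (k - 1)\<bar> * f (g t)) = t powr (x - 1) * exp (- (t powr k) / k)"
    if "t \<in> {0<..}" for t
  proof -
    have t: "t > 0" using that by simp
    have fg: "f (g t) = (t powr (k * (y - 1)) / k powr (y - 1)) * exp (- (t powr k) / k)"
      using t k by (simp add: f_def g_def powr_divide powr_powr exp_minus flip: divide_inverse)
    have "k powr (y - 1) * (\<bar>t powr (k - 1)\<bar> * f (g t)) =
        (t powr (k - 1) * t powr (k * (y - 1))) * exp (- (t powr k) / k)"
      unfolding fg using k by simp
    also have "t powr (k - 1) * t powr (k * (y - 1)) = t powr (x - 1)"
      using k by (simp add: powr_add[symmetric] y_def algebra_simps)
    finally show ?thesis .
  qed
  ultimately have "((\<lambda>t. t powr (x - 1) * exp (- (t powr k) / k)) has_integral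
      k powr (y - 1) * Gamma y) {0<..}"
    by (rule has_integral_eq[rotated])
  thus ?thesis unfolding y_def
    by (simp only: has_integral_Ici_iff_Ioi)
qed

lemma k_Gamma_eq:
  assumes "k > 0" "x > 0"
  shows "k_Gamma k (of_real x) = of_real (k powr (x / k - 1) * Gamma (x / k))"
proof -
  have "((\<lambda>t. complex_of_real (t powr (x - 1) * exp (- (t powr k) / k))) has_integral
      of_real (k powr (x / k - 1) * Gamma (x / k))) {0..}"
    using has_integral_linear[OF k_Gamma_integral_real[OF assms] bounded_linear_of_real]
    by (simp add: o_def)
  hence "((\<lambda>t. of_real t powr (of_real x - 1) * of_real (exp (- (t powr k) / k))) has_integral
      complex_of_real (k powr (x / k - 1) * Gamma (x / k))) {0..}"
    by (rule has_integral_eq[rotated]) (simp add: powr_of_real[symmetric])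
  thus ?thesis unfolding k_Gamma_def by (rule integral_unique)
qed

lemma k_Gamma_shift:
  assumes k: "k > 0" and \<nu>: "\<nu> > 0"
  shows "k_Gamma k (of_real (real n * k + \<nu> + k)) =
     of_real (k ^ n) * pochhammer (of_real (\<nu> / k) + 1) n * k_Gamma k (of_real (\<nu> + k))"
    and "k_Gamma k (of_real (\<nu> + k)) \<noteq> 0"
proof -
  define a where "a = \<nu> / k"
  have a: "a > 0" using assms by (simp add: a_def)
  have e: "(real n * k + \<nu> + k) / k = real n + (a + 1)" for n
    using k by (simp add: a_def field_simps)
  have e0: "(\<nu> + k) / k = a + 1" using k by (simp add: a_def field_simps)
  have pos: "real n * k + \<nu> + k > 0" for n using k \<nu> by (intro add_nonneg_pos add_nonneg_nonneg) auto
  have G: "Gamma (a + 1) > 0" using a by (intro Gamma_real_pos) auto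
  have poch: "Gamma (real n + (a + 1)) = pochhammer (a + 1) n * Gamma (a + 1)"
  proof -
    have "a + 1 \<notin> \<int>\<^sub>\<le>\<^sub>0" using nonpos_Ints_nonpos[of "a + 1"] a by force
    hence "pochhammer (a + 1) n = Gamma (a + 1 + real n) / Gamma (a + 1)" by (rule pochhammer_Gamma)
    thus ?thesis using G by (simp add: add_ac)
  qed
  have e1: "real n + (a + 1) - 1 = real n + a" by simp
  have kp: "k powr (real n + a) = k ^ n * k powr a" using k by (simp add: powr_add powr_realpow)
  have k0: "k_Gamma k (of_real (\<nu> + k)) = of_real (k powr a * Gamma (a + 1))"
    using k_Gamma_eq[OF k, of "\<nu> + k"] k \<nu> unfolding e0 by simp
  show "k_Gamma k (of_real (\<nu> + k)) \<noteq> 0" unfolding k0 using k G by simp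
  have "k_Gamma k (of_real (real n * k + \<nu> + k)) =
      of_real (k powr (real n + (a + 1) - 1) * Gamma (real n + (a + 1)))"
    using k_Gamma_eq[OF k pos[of n]] unfolding e .
  also have "\<dots> = of_real (k ^ n) * of_real (pochhammer (a + 1) n) * of_real (k powr a * Gamma (a + 1))"
    unfolding poch e1 kp of_real_mult by (simp only: mult_ac)
  also have "complex_of_real (pochhammer (a + 1) n) = pochhammer (of_real a + 1) n"
    by (metis of_real_1 of_real_add pochhammer_of_real)
  finally show "k_Gamma k (of_real (real n * k + \<nu> + k)) =
     of_real (k ^ n) * pochhammer (of_real (\<nu> / k) + 1) n * k_Gamma k (of_real (\<nu> + k))"
    unfolding k0 a_def .
qed

section \<open>The k-Bessel functions in terms of the Bessel function\<close>

lemma sums_bessel_phi: "a > 0 \<Longrightarrow> (\<lambda>n. fps_nth (bessel_fps a) n * u ^ n) sums bessel_phi a u"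
  unfolding bessel_phi_def by (rule sums_eval_fps) simp

lemma k_Bessel_coeff_sums:
  assumes k: "k > 0" and \<nu>: "\<nu> > 0"
  shows "(\<lambda>n. of_real ((- c) ^ n) / (fact n * k_Gamma k (of_real (real n * k + \<nu> + k))) * (z / 2) ^ (2 * n))
           sums (bessel_phi (\<nu> / k) (of_real (c / (4 * k)) * z ^ 2) / k_Gamma k (of_real (\<nu> + k)))"
proof -
  have a: "\<nu> / k > 0" using k \<nu> by simp
  define G where "G = k_Gamma k (of_real (\<nu> + k))"
  have G: "G \<noteq> 0" unfolding G_def by (rule k_Gamma_shift(2)[OF k \<nu>])
  have "of_real ((- c) ^ n) / (fact n * k_Gamma k (of_real (real n * k + \<nu> + k))) * (z / 2) ^ (2 * n)
      = fps_nth (bessel_fps (\<nu> / k)) n * (of_real (c / (4 * k)) * z ^ 2) ^ n / G" for n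
  proof -
    define p where "p = pochhammer (complex_of_real (\<nu> / k) + 1) n"
    have "(z / 2) ^ (2 * n) = (z ^ 2 / 4) ^ n" by (simp add: power_mult power_divide)
    moreover have "of_real ((- c) ^ n) = (-1) ^ n * complex_of_real c ^ n"
      by (simp flip: power_mult_distrib)
    ultimately show ?thesis
      unfolding k_Gamma_shift(1)[OF k \<nu>] G_def[symmetric] bessel_fps_def fps_nth_Abs_fps p_def[symmetric]
      using k by (simp add: power_divide power_mult_distrib mult_ac)
  qed
  thus ?thesis using sums_divide[OF sums_bessel_phi[OF a]] unfolding G_def by simp
qed

lemma k_Bessel_w_eq:
  assumes "k > 0" "\<nu> > 0"
  shows "k_Bessel_w k \<nu> c z = bessel_phi (\<nu> / k) (of_real (c / (4 * k)) * z ^ 2)"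
  unfolding k_Bessel_w_def sums_unique[OF k_Bessel_coeff_sums[OF assms], symmetric]
  using k_Gamma_shift(2)[OF assms] by simp

text \<open>This also holds at \<open>z = 0\<close>, where both sides vanish because of \<open>0 powr w = 0\<close>.\<close>

lemma k_Bessel_W_eq:
  assumes "k > 0" "\<nu> > 0"
  shows "k_Bessel_W k \<nu> c z = (z / 2) powr of_real (\<nu> / k) *
    bessel_phi (\<nu> / k) (of_real (c / (4 * k)) * z ^ 2) / k_Gamma k (of_real (\<nu> + k))"
proof (cases "z = 0")
  case True
  thus ?thesis by (simp add: k_Bessel_W_def)
next
  case False
  hence "(z / 2) powr of_real (2 * real n + \<nu> / k) = (z / 2) powr of_real (\<nu> / k) * (z / 2) ^ (2 * n)" for n
    using powr_nat'[of "z / 2" "2 * n"] by (simp add: powr_add mult.commute)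
  hence "k_Bessel_W k \<nu> c z = (\<Sum>n. (z / 2) powr of_real (\<nu> / k) *
     (of_real ((- c) ^ n) / (fact n * k_Gamma k (of_real (real n * k + \<nu> + k))) * (z / 2) ^ (2 * n)))"
    unfolding k_Bessel_W_def by (simp only: mult.left_commute)
  also have "\<dots> = (z / 2) powr of_real (\<nu> / k) *
    (bessel_phi (\<nu> / k) (of_real (c / (4 * k)) * z ^ 2) / k_Gamma k (of_real (\<nu> + k)))"
    by (rule sums_unique[symmetric, OF sums_mult[OF k_Bessel_coeff_sums[OF assms]]])
  finally show ?thesis by simp
qed

lemma half_powr:
  assumes "z \<noteq> 0"
  shows "(z / 2) powr of_real a = z powr of_real a / complex_of_real (2 powr a)"
proof -
  have "Ln (z / 2) = Ln z - of_real (ln 2)"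
    using Ln_divide_of_real[of 2 z] assms by simp
  hence "(z / 2) powr of_real a = exp (of_real a * Ln z) / exp (of_real (a * ln 2))"
    using assms by (simp only: powr_def exp_diff[symmetric] right_diff_distrib) simp
  thus ?thesis using assms by (simp add: powr_def flip: exp_of_real)
qed

lemma k_Bessel_g_eq:
  assumes "k > 0" "\<nu> > 0"
  shows "k_Bessel_g k \<nu> c z = z * bessel_phi (\<nu> / k) (of_real (c / (4 * k)) * z ^ 2)"
proof (cases "z = 0")
  case False
  define a where "a = \<nu> / k"
  have "z powr of_real (1 - a) * z powr of_real a = z"
    using False by (simp add: powr_add[symmetric])
  moreover have "k_Bessel_g k \<nu> c z = (z powr of_real (1 - a) * z powr of_real a) *
      bessel_phi a (of_real (c / (4 * k)) * z ^ 2)"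
    unfolding k_Bessel_g_def k_Bessel_W_eq[OF assms] half_powr[OF False] a_def
    using k_Gamma_shift(2)[OF assms] by simp
  ultimately show ?thesis by (simp add: a_def)
qed (simp add: k_Bessel_g_def)

lemma k_Bessel_h_eq:
  assumes "k > 0" "\<nu> > 0"
  shows "k_Bessel_h k \<nu> c z = z * bessel_phi (\<nu> / k) (of_real (c / (4 * k)) * z ^ 1)"
proof (cases "z = 0")
  case False
  define a where "a = \<nu> / k"
  have L: "Ln (csqrt z) = Ln z / 2"
    unfolding csqrt_exp_Ln[OF False] using Im_Ln_le_pi[OF False] mpi_less_Im_Ln[OF False] by (intro Ln_exp) auto
  have cz: "csqrt z \<noteq> 0" using False by simp
  have "csqrt z powr of_real a = z powr of_real (a / 2)"
    using False by (simp add: powr_def L)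
  moreover have "z powr of_real (1 - a / 2) * z powr of_real (a / 2) = z"
    using False by (simp add: powr_add[symmetric])
  moreover have "k_Bessel_h k \<nu> c z = (z powr of_real (1 - a / 2) * csqrt z powr of_real a) *
      bessel_phi a (of_real (c / (4 * k)) * z ^ 1)"
    unfolding k_Bessel_h_def k_Bessel_W_eq[OF assms] half_powr[OF cz] a_def
    using k_Gamma_shift(2)[OF assms] by (simp add: mult.commute)
  ultimately show ?thesis by (simp add: a_def)
qed (simp add: k_Bessel_h_def)

section \<open>Radii of convexity of the normalized functions\<close>

lemma has_field_derivative_bessel_phi_monomial:
  assumes "a > 0" "bessel_phi a (of_real q * z ^ m) \<noteq> 0"
  shows "((\<lambda>z. bessel_phi a (of_real q * z ^ m)) has_field_derivative
     - bessel_p a (of_real q * z ^ m) * bessel_phi a (of_real q * z ^ m) *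
       (of_real q * (of_nat m * z ^ (m - 1)))) (at z)"
  by (rule DERIV_chain2[where f = "bessel_phi a" and g = "\<lambda>z. of_real q * z ^ m",
        OF has_field_derivative_bessel_phi[OF assms]])
     (auto intro!: derivative_eq_intros)

text \<open>The link between the power series bound and the geometry: under these hypotheses
  \<open>1 + z F'' / F'\<close> is \<open>1\<close> minus the convexity series at \<open>q z\<^sup>m\<close>.\<close>

lemma convexity_radius_of_log_derivative:
  assumes a: "a > 0" and m: "m \<ge> 1" and r: "0 < r" "r < \<rho>"
    and nz: "\<And>z. z \<in> ball 0 \<rho> \<Longrightarrow> bessel_phi a (of_real q * z ^ m) \<noteq> 0"
    and ne1: "\<And>z. z \<in> ball 0 \<rho> \<Longrightarrow> of_real \<gamma> * (of_real q * z ^ m) * bessel_p a (of_real q * z ^ m) \<noteq> 1"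
    and root: "convexity_series a m \<beta> \<gamma> (of_real q * of_real r ^ m) = of_real (1 - \<alpha>)"
    and less: "\<And>z. z \<in> ball 0 r \<Longrightarrow> Re (convexity_series a m \<beta> \<gamma> (of_real q * z ^ m)) < 1 - \<alpha>"
    and F: "F holomorphic_on ball 0 \<rho>"
    and dF: "\<And>z. z \<in> ball 0 \<rho> \<Longrightarrow>
        deriv F z = E z * (1 - of_real \<gamma> * (of_real q * z ^ m) * bessel_p a (of_real q * z ^ m))"
    and E: "\<And>z. z \<in> ball 0 \<rho> \<Longrightarrow> E z \<noteq> 0"
      "\<And>z. z \<in> ball 0 \<rho> \<Longrightarrow> (E has_field_derivative E' z) (at z)"
      "\<And>z. z \<in> ball 0 \<rho> \<Longrightarrow>
         z * E' z = - (of_nat m * (of_real q * z ^ m) * (of_real \<beta> * bessel_p a (of_real q * z ^ m))) * E z"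
  shows "radius_of_convexity \<alpha> F = ereal r" "is_smallest_pos (convexity_eq F \<alpha>) r"
proof -
  note quot = log_derivative_of_deriv[OF a m open_ball[of 0 \<rho>] _ nz ne1 dF E]
  have q1: "deriv F z \<noteq> 0" if "z \<in> ball 0 \<rho>" for z
    using quot(1)[OF that] that by blast
  have q2: "1 + z * deriv (deriv F) z / deriv F z = 1 - convexity_series a m \<beta> \<gamma> (of_real q * z ^ m)"
    if z: "z \<in> ball 0 \<rho>" for z
  proof -
    have "z * deriv (deriv F) z / deriv F z =
      - (of_nat m * (of_real q * z ^ m) * (of_real \<beta> * bessel_p a (of_real q * z ^ m))) -
      of_nat m * (of_real q * z ^ m) *
      (of_real \<gamma> * (bessel_p a (of_real q * z ^ m) + of_real q * z ^ m *
        deriv (bessel_p a) (of_real q * z ^ m))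
        / (1 - of_real \<gamma> * (of_real q * z ^ m) * bessel_p a (of_real q * z ^ m)))"
      by (rule quot(2)) (use z in auto)
    thus ?thesis unfolding convexity_series_def distrib_left[of "of_nat m * (of_real q * z ^ m)"] by simp
  qed
  show "radius_of_convexity \<alpha> F = ereal r"
    by (rule radius_of_convexity_eqI[OF F r q1 q2 root less])
  show "is_smallest_pos (convexity_eq F \<alpha>) r"
  proof (rule smallest_convexity_root[where
        \<kappa> = "\<lambda>z. convexity_series a m \<beta> \<gamma> (of_real q * z ^ m)", OF r _ root less])
    fix s assume "0 < s" "s < \<rho>"
    hence s: "complex_of_real s \<in> ball 0 \<rho>" by simp
    show "convexity_eq F \<alpha> s \<longleftrightarrow> 1 - convexity_series a m \<beta> \<gamma> (of_real q * of_real s ^ m) = of_real \<alpha>"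
      using q1[OF s] q2[OF s] by (simp add: convexity_eq_def Let_def)
  qed
qed

text \<open>Here \<open>F' = \<phi>(u) + m u \<phi>'(u) = \<phi>(u) (1 - m u p(u))\<close> at \<open>u = q z\<^sup>m\<close>, so \<open>E = \<phi>(q z\<^sup>m)\<close>,
  \<open>\<beta> = 1\<close> and \<open>\<gamma> = m\<close>.\<close>

lemma convexity_radius_z_bessel_phi:
  assumes a: "a > 0" and m: "m \<ge> 1" and q: "q > 0" and \<alpha>: "0 \<le> \<alpha>" "\<alpha> < 1"
  defines "F \<equiv> \<lambda>z. z * bessel_phi a (of_real q * z ^ m)"
  shows "\<exists>r. is_smallest_pos (convexity_eq F \<alpha>) r \<and> radius_of_convexity \<alpha> F = ereal r"
proof -
  have g: "real m > 0" "1 \<ge> (0::real)" using m by auto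
  obtain r \<rho> where r: "0 < r" "r < \<rho>"
    and nz: "\<And>z. z \<in> ball 0 \<rho> \<Longrightarrow> bessel_phi a (of_real q * z ^ m) \<noteq> 0"
    and ne1: "\<And>z. z \<in> ball 0 \<rho> \<Longrightarrow> of_real (real m) * (of_real q * z ^ m) * bessel_p a (of_real q * z ^ m) \<noteq> 1"
    and root: "convexity_series a m 1 (real m) (of_real q * of_real r ^ m) = of_real (1 - \<alpha>)"
    and less: "\<And>z. z \<in> ball 0 r \<Longrightarrow> Re (convexity_series a m 1 (real m) (of_real q * z ^ m)) < 1 - \<alpha>"
    using exists_convexity_radius[OF a m g(2,1) \<alpha> q] by blast
  define E where "E z = bessel_phi a (of_real q * z ^ m)" for z
  define E' where "E' z = - bessel_p a (of_real q * z ^ m) * bessel_phi a (of_real q * z ^ m) *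
      (of_real q * (of_nat m * z ^ (m - 1)))" for z
  have zm: "z * z ^ (m - 1) = z ^ m" for z :: complex using m by (cases m) auto
  have dE: "(E has_field_derivative E' z) (at z)" if "z \<in> ball 0 \<rho>" for z
    unfolding E_def E'_def by (rule has_field_derivative_bessel_phi_monomial[OF a nz[OF that]])
  have zE': "z * E' z =
      - (of_nat m * (of_real q * z ^ m) * (of_real 1 * bessel_p a (of_real q * z ^ m))) * E z" for z
    unfolding E_def E'_def zm[of z, symmetric] by simp
  have dF: "(F has_field_derivative E z + z * E' z) (at z)" if z: "z \<in> ball 0 \<rho>" for z
    unfolding F_def E_def[symmetric] using dE[OF z] by (auto intro!: derivative_eq_intros)
  have F: "F holomorphic_on ball 0 \<rho>"
    using dF unfolding holomorphic_on_open[OF open_ball] by blast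
  have dF': "deriv F z = E z * (1 - of_real (real m) * (of_real q * z ^ m) * bessel_p a (of_real q * z ^ m))"
    if z: "z \<in> ball 0 \<rho>" for z
    unfolding DERIV_imp_deriv[OF dF[OF z]] zE' by (simp add: algebra_simps)
  have E0: "E z \<noteq> 0" if "z \<in> ball 0 \<rho>" for z using nz[OF that] by (simp add: E_def)
  show ?thesis
    using convexity_radius_of_log_derivative[OF a m r nz ne1 root less F dF' E0 dE zE'] by blast
qed

text \<open>The disk is convex as a union of concentric balls, so the nonvanishing function \<open>w\<close> has a
  holomorphic logarithm on it, and \<open>w(0) = 1\<close> allows the normalization at \<open>0\<close>. Hence the choice that
  defines the logarithm is not vacuous.\<close>

lemma k_Bessel_log_w:
  assumes "k > 0" "\<nu> > 0"
  shows "k_Bessel_log_w k \<nu> c holomorphic_on k_Bessel_disk k \<nu> c"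
    and "\<And>z. z \<in> k_Bessel_disk k \<nu> c \<Longrightarrow> exp (k_Bessel_log_w k \<nu> c z) = k_Bessel_w k \<nu> c z"
proof -
  define D where "D = k_Bessel_disk k \<nu> c"
  have a: "\<nu> / k > 0" using assms by simp
  have wh: "k_Bessel_w k \<nu> c holomorphic_on S" for S
    unfolding k_Bessel_w_eq[OF assms, abs_def]
    by (intro holomorphic_on_compose_gen[OF _ holomorphic_bessel_phi[OF a], of _ _ UNIV, unfolded o_def]
        holomorphic_intros) auto
  have nz: "k_Bessel_w k \<nu> c z \<noteq> 0" if "z \<in> D" for z using that by (auto simp: D_def k_Bessel_disk_def)
  have opD: "open D" unfolding D_def k_Bessel_disk_def by auto
  have "convex D"
  proof (rule convexI)
    fix x y :: complex and u v :: real assume xy: "x \<in> D" "y \<in> D" and uv: "0 \<le> u" "0 \<le> v" "u + v = 1"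
    then obtain r s where rs: "x \<in> ball 0 r" "\<forall>z\<in>ball 0 r. k_Bessel_w k \<nu> c z \<noteq> 0"
       "y \<in> ball 0 s" "\<forall>z\<in>ball 0 s. k_Bessel_w k \<nu> c z \<noteq> 0"
      by (auto simp: D_def k_Bessel_disk_def)
    have "x \<in> ball 0 (max r s)" "y \<in> ball 0 (max r s)" using rs by auto
    hence "u *\<^sub>R x + v *\<^sub>R y \<in> ball 0 (max r s)" using uv convex_ball[of 0 "max r s"] by (meson convexD)
    moreover have "\<forall>z\<in>ball 0 (max r s). k_Bessel_w k \<nu> c z \<noteq> 0" using rs by (auto simp: max_def)
    ultimately show "u *\<^sub>R x + v *\<^sub>R y \<in> D" unfolding D_def k_Bessel_disk_def by blast
  qed
  then obtain L where L: "L holomorphic_on D" "\<And>z. z \<in> D \<Longrightarrow> k_Bessel_w k \<nu> c z = exp (L z)"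
    using simply_connected_imp_holomorphic_log[OF wh _ _ nz]
      convex_imp_simply_connected[of D] open_imp_locally_path_connected[OF opD] by metis
  have w0: "k_Bessel_w k \<nu> c 0 = 1" by (simp add: k_Bessel_w_eq[OF assms])
  have ex: "\<exists>L. L holomorphic_on k_Bessel_disk k \<nu> c \<and> L 0 = 0 \<and>
        (\<forall>z\<in>k_Bessel_disk k \<nu> c. exp (L z) = k_Bessel_w k \<nu> c z)"
  proof (cases "0 \<in> D")
    case True
    have "exp (L 0) = 1" using L(2)[OF True] w0 by simp
    with L show ?thesis unfolding D_def[symmetric]
      by (intro exI[of _ "\<lambda>z. L z - L 0"]) (auto intro!: holomorphic_intros simp: exp_diff)
  next
    case False
    \<comment> \<open>a union of balls around \<open>0\<close> that misses \<open>0\<close> is empty, so any function will do\<close>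
    have "D = {}"
    proof (rule ccontr)
      assume "D \<noteq> {}"
      then obtain x r where "x \<in> ball (0 :: complex) r" "\<forall>z\<in>ball 0 r. k_Bessel_w k \<nu> c z \<noteq> 0"
        by (auto simp: D_def k_Bessel_disk_def)
      moreover from this have "0 \<in> ball (0 :: complex) r" by (auto intro: le_less_trans[OF norm_ge_zero])
      ultimately have "0 \<in> D" unfolding D_def k_Bessel_disk_def by blast
      with False show False ..
    qed
    thus ?thesis unfolding D_def[symmetric] by (intro exI[of _ "\<lambda>_. 0"]) auto
  qed
  show "k_Bessel_log_w k \<nu> c holomorphic_on k_Bessel_disk k \<nu> c"
    and "\<And>z. z \<in> k_Bessel_disk k \<nu> c \<Longrightarrow> exp (k_Bessel_log_w k \<nu> c z) = k_Bessel_w k \<nu> c z"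
    using someI_ex[OF ex] unfolding k_Bessel_log_w_def by blast+
qed

text \<open>In the right half plane \<open>z W' / W = a (1 - \<psi>)\<close> with \<open>\<psi> = (2/a) u p(u)\<close>, \<open>u = q z\<^sup>2\<close>. Hence
  \<open>W' = E (1 - \<psi>)\<close> for \<open>E = a W / z\<close> and \<open>z E' / E = a (1 - \<psi>) - 1\<close>. In the left-hand side of the
  equation the multiples of \<open>a (1 - \<psi>)\<close> cancel, and \<open>1 - \<psi> - 2 u \<psi>' / (1 - \<psi>)\<close> remains.\<close>

lemma convexity_eq_W_iff:
  fixes k c \<nu> \<alpha> s \<rho> :: real
  assumes k: "k > 0" and \<nu>: "\<nu> > 0" and s: "0 < s" "s < \<rho>"
  defines "a \<equiv> \<nu> / k" and "q \<equiv> c / (4 * k)"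
  assumes nz: "\<And>z. z \<in> ball 0 \<rho> \<Longrightarrow> bessel_phi a (of_real q * z ^ 2) \<noteq> 0"
    and ne1: "\<And>z. z \<in> ball 0 \<rho> \<Longrightarrow> of_real (2 / a) * (of_real q * z ^ 2) * bessel_p a (of_real q * z ^ 2) \<noteq> 1"
  shows "convexity_eq_W k \<nu> c \<alpha> s \<longleftrightarrow>
    1 - convexity_series a 2 (1 / a) (2 / a) (of_real q * of_real s ^ 2) = of_real \<alpha>"
proof -
  have a: "a > 0" using k \<nu> by (simp add: a_def)
  define W where "W = k_Bessel_W k \<nu> c"
  define S where "S = ball 0 \<rho> \<inter> {z. Re z > 0}"
  have S0: "z \<noteq> 0" if "z \<in> S" for z using that by (auto simp: S_def)
  have opS: "open S" unfolding S_def by (intro open_Int open_ball open_halfspace_Re_gt)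
  define x where "x = complex_of_real s"
  have xS: "x \<in> S" using s by (simp add: S_def x_def)
  have x0: "x \<noteq> 0" using s by (simp add: x_def)
  define U where "U z = of_real q * z ^ 2" for z :: complex
  define X where "X z = 1 - of_real (2 / a) * U z * bessel_p a (U z)" for z
  have dW: "(W has_field_derivative of_real a / z * W z * X z) (at z)" if z: "z \<in> S" for z
  proof -
    have z': "z \<in> ball 0 \<rho>" "Re z > 0" using z by (auto simp: S_def)
    have z0: "z \<noteq> 0" using z' by auto
    have zn: "z / 2 \<notin> \<real>\<^sub>\<le>\<^sub>0" using z'(2) by (auto simp: complex_nonpos_Reals_iff)
    define C where "C = k_Gamma k (of_real (\<nu> + k))"
    have C: "C \<noteq> 0" unfolding C_def by (rule k_Gamma_shift(2)[OF k \<nu>])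
    have W: "W z = exp (of_real a * Ln (z / 2)) * bessel_phi a (of_real q * z ^ 2) / C" if "z \<noteq> 0" for z
      using that unfolding W_def k_Bessel_W_eq[OF k \<nu>] C_def a_def q_def by (simp add: powr_def)
    have "((\<lambda>z. exp (of_real a * Ln (z / 2))) has_field_derivative
        exp (of_real a * Ln (z / 2)) * (of_real a / z)) (at z)"
      using z0 zn by (auto intro!: derivative_eq_intros)
    moreover have "((\<lambda>z. bessel_phi a (of_real q * z ^ 2)) has_field_derivative
        - bessel_p a (of_real q * z ^ 2) * bessel_phi a (of_real q * z ^ 2) *
         (of_real q * (of_nat 2 * z ^ (2 - 1)))) (at z)"
      by (rule has_field_derivative_bessel_phi_monomial[OF a nz[OF z'(1)]])
    ultimately have "((\<lambda>z. exp (of_real a * Ln (z / 2)) * bessel_phi a (of_real q * z ^ 2)) has_field_derivative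
       exp (of_real a * Ln (z / 2)) * (of_real a / z) * bessel_phi a (of_real q * z ^ 2) +
       (- bessel_p a (of_real q * z ^ 2) * bessel_phi a (of_real q * z ^ 2) *
         (of_real q * (of_nat 2 * z ^ (2 - 1))))
        * exp (of_real a * Ln (z / 2))) (at z)"
      by (rule DERIV_mult)
    hence "((\<lambda>z. exp (of_real a * Ln (z / 2)) * bessel_phi a (of_real q * z ^ 2) / C) has_field_derivative
       (exp (of_real a * Ln (z / 2)) * (of_real a / z) * bessel_phi a (of_real q * z ^ 2) +
       (- bessel_p a (of_real q * z ^ 2) * bessel_phi a (of_real q * z ^ 2) *
         (of_real q * (of_nat 2 * z ^ (2 - 1))))
        * exp (of_real a * Ln (z / 2))) / C) (at z)"
      by (rule DERIV_cdivide)
    also have "(exp (of_real a * Ln (z / 2)) * (of_real a / z) * bessel_phi a (of_real q * z ^ 2) +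
       (- bessel_p a (of_real q * z ^ 2) * bessel_phi a (of_real q * z ^ 2) *
         (of_real q * (of_nat 2 * z ^ (2 - 1))))
        * exp (of_real a * Ln (z / 2))) / C = of_real a / z * W z * X z"
      unfolding W[OF z0] X_def U_def using z0 C a by (simp add: field_simps power2_eq_square)
    finally show ?thesis
      by (rule has_field_derivative_transform_within_open[OF _ opS z])
         (use S0 in \<open>auto simp: W\<close>)
  qed
  define E where "E z = of_real a / z * W z" for z
  define E' where "E' = of_real a / x * (of_real a / x * W x * X x) - of_real a / x ^ 2 * W x"
  have "(E has_field_derivative E') (at x)"
    unfolding E_def E'_def using dW[OF xS] x0
    by (auto intro!: derivative_eq_intros simp: field_simps power2_eq_square)
  have zE': "x * E' = (of_real a * X x - 1) * E x"
    unfolding E'_def E_def using x0 by (simp add: field_simps power2_eq_square)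
  have Wx: "W x \<noteq> 0" using nz[of x] x0 xS k_Gamma_shift(2)[OF k \<nu>]
    unfolding W_def k_Bessel_W_eq[OF k \<nu>] a_def q_def by (auto simp: S_def)
  have Ex: "E x \<noteq> 0" using Wx x0 a by (simp add: E_def)
  have dWE: "deriv W z = E z * (1 - of_real (2 / a) * (of_real q * z ^ 2) * bessel_p a (of_real q * z ^ 2))"
    if "z \<in> S" for z
    using DERIV_imp_deriv[OF dW[OF that]] by (simp add: E_def X_def U_def)
  have nzS: "bessel_phi a (of_real q * z ^ 2) \<noteq> 0"
    and ne1S: "of_real (2 / a) * (of_real q * z ^ 2) * bessel_p a (of_real q * z ^ 2) \<noteq> 1" if "z \<in> S" for z
    using nz ne1 that by (auto simp: S_def)
  note quot = log_derivative_of_deriv[where m = 2, OF a _ opS xS nzS ne1S dWE Ex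
      \<open>(E has_field_derivative E') (at x)\<close> zE']
  have d0: "deriv W x \<noteq> 0" by (rule quot(1)) auto
  define N where "N = of_nat 2 * (of_real q * x ^ 2) *
      (of_real (2 / a) * (bessel_p a (of_real q * x ^ 2) + (of_real q * x ^ 2) *
        deriv (bessel_p a) (of_real q * x ^ 2))
        / (1 - of_real (2 / a) * (of_real q * x ^ 2) * bessel_p a (of_real q * x ^ 2)))"
  have "x * deriv (deriv W) x / deriv W x = of_real a * X x - 1 - N"
    unfolding N_def by (rule quot(2)) auto
  hence W'': "x * (deriv (deriv W) x / deriv W x) = of_real a * X x - 1 - N" by simp
  have "x * (deriv W x / W x) = of_real a * X x"
    using DERIV_imp_deriv[OF dW[OF xS]] Wx x0 by simp
  hence "of_real (k / \<nu> - 1) * x * (deriv W x / W x) = of_real (k / \<nu> - 1) * (of_real a * X x)"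
    by (simp only: mult.assoc)
  also have "\<dots> = X x - of_real a * X x"
  proof -
    have "(k / \<nu> - 1) * a = 1 - a" using k \<nu> by (simp add: a_def field_simps)
    hence "of_real (k / \<nu> - 1) * complex_of_real a = 1 - of_real a"
      by (metis of_real_1 of_real_diff of_real_mult)
    thus ?thesis by (simp only: mult.assoc[symmetric] left_diff_distrib mult_1)
  qed
  finally have W': "of_real (k / \<nu> - 1) * x * (deriv W x / W x) = X x - of_real a * X x" .
  have "X x = 1 - of_nat 2 * (of_real q * x ^ 2) * (of_real (1 / a) * bessel_p a (of_real q * x ^ 2))"
    by (simp add: X_def U_def)
  hence "convexity_series a 2 (1 / a) (2 / a) (of_real q * x ^ 2) = 1 - X x + N"
    unfolding convexity_series_def N_def distrib_left[of "of_nat 2 * (of_real q * x ^ 2)"] by simp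
  hence lhs: "1 + x * (deriv (deriv W) x / deriv W x) + of_real (k / \<nu> - 1) * x * (deriv W x / W x)
     = 1 - convexity_series a 2 (1 / a) (2 / a) (of_real q * x ^ 2)"
    unfolding W'' W' by simp
  show ?thesis
    unfolding convexity_eq_W_def Let_def W_def[symmetric] x_def[symmetric] lhs using d0 Wx by blast
qed

text \<open>From \<open>f = z w\<^bsup>1/a\<^esup>\<close> one gets \<open>f' = w\<^bsup>1/a\<^esup> (1 - (2/a) u p(u))\<close> at \<open>u = q z\<^sup>2\<close>, so \<open>E = w\<^bsup>1/a\<^esup>\<close>,
  \<open>\<beta> = 1/a\<close> and \<open>\<gamma> = 2/a\<close>.\<close>

lemma convexity_radius_k_Bessel_f:
  assumes k: "k > 0" and c: "c > 0" and \<nu>: "\<nu> > 0" and \<alpha>: "0 \<le> \<alpha>" "\<alpha> < 1"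
  shows "\<exists>r. is_smallest_pos (convexity_eq_W k \<nu> c \<alpha>) r \<and>
           radius_of_convexity \<alpha> (k_Bessel_f k \<nu> c) = ereal r"
proof -
  define a q where "a = \<nu> / k" and "q = c / (4 * k)"
  have a: "a > 0" and q: "q > 0" using k \<nu> c by (auto simp: a_def q_def)
  have g: "1 / a \<ge> 0" "2 / a > 0" "(2::nat) \<ge> 1" using a by auto
  obtain r \<rho> where r: "0 < r" "r < \<rho>"
    and nz: "\<And>z. z \<in> ball 0 \<rho> \<Longrightarrow> bessel_phi a (of_real q * z ^ 2) \<noteq> 0"
    and ne1: "\<And>z. z \<in> ball 0 \<rho> \<Longrightarrow> of_real (2 / a) * (of_real q * z ^ 2) * bessel_p a (of_real q * z ^ 2) \<noteq> 1"
    and root: "convexity_series a 2 (1 / a) (2 / a) (of_real q * of_real r ^ 2) = of_real (1 - \<alpha>)"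
    and less: "\<And>z. z \<in> ball 0 r \<Longrightarrow> Re (convexity_series a 2 (1 / a) (2 / a) (of_real q * z ^ 2)) < 1 - \<alpha>"
    using exists_convexity_radius[OF a g(3,1,2) \<alpha> q] by blast
  have w: "k_Bessel_w k \<nu> c z = bessel_phi a (of_real q * z ^ 2)" for z
    unfolding a_def q_def by (rule k_Bessel_w_eq[OF k \<nu>])
  have sub: "ball 0 \<rho> \<subseteq> k_Bessel_disk k \<nu> c"
    unfolding k_Bessel_disk_def w using nz by blast
  define L where "L = k_Bessel_log_w k \<nu> c"
  have L: "L holomorphic_on ball 0 \<rho>"
    unfolding L_def by (rule holomorphic_on_subset[OF k_Bessel_log_w(1)[OF k \<nu>] sub])
  have expL: "exp (L z) = bessel_phi a (of_real q * z ^ 2)" if "z \<in> ball 0 \<rho>" for z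
    using k_Bessel_log_w(2)[OF k \<nu> subsetD[OF sub that]] by (simp only: L_def w)
  define L' where "L' z = - bessel_p a (of_real q * z ^ 2) * (of_real q * (2 * z))" for z
  have dL: "(L has_field_derivative L' z) (at z)" if z: "z \<in> ball 0 \<rho>" for z
  proof (rule has_field_derivative_log_branch[OF open_ball L expL z])
    show "((\<lambda>z. bessel_phi a (of_real q * z ^ 2)) has_field_derivative
        L' z * bessel_phi a (of_real q * z ^ 2)) (at z)"
      using has_field_derivative_bessel_phi_monomial[OF a nz[OF z]] by (simp add: L'_def mult_ac)
  qed
  define E where "E z = exp (of_real (1 / a) * L z)" for z
  define E' where "E' z = of_real (1 / a) * L' z * E z" for z
  define F where "F = k_Bessel_f k \<nu> c"
  have Fz: "F z = z * E z" for z
    using k \<nu> by (simp add: F_def k_Bessel_f_def E_def L_def a_def)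
  have dE: "(E has_field_derivative E' z) (at z)" if z: "z \<in> ball 0 \<rho>" for z
    unfolding E_def E'_def using a dL[OF z] by (auto intro!: derivative_eq_intros)
  have zE': "z * E' z =
      - (of_nat 2 * (of_real q * z ^ 2) * (of_real (1 / a) * bessel_p a (of_real q * z ^ 2))) * E z" for z
    by (simp add: E'_def L'_def power2_eq_square)
  have dF: "(F has_field_derivative E z + z * E' z) (at z)" if z: "z \<in> ball 0 \<rho>" for z
    unfolding Fz[abs_def] using dE[OF z] by (auto intro!: derivative_eq_intros)
  have F: "F holomorphic_on ball 0 \<rho>"
    using dF unfolding holomorphic_on_open[OF open_ball] by blast
  have dF': "deriv F z = E z * (1 - of_real (2 / a) * (of_real q * z ^ 2) * bessel_p a (of_real q * z ^ 2))"
    if z: "z \<in> ball 0 \<rho>" for z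
    unfolding DERIV_imp_deriv[OF dF[OF z]] zE' by (simp add: algebra_simps)
  have E0: "E z \<noteq> 0" for z by (simp add: E_def)
  have "radius_of_convexity \<alpha> F = ereal r"
    by (rule convexity_radius_of_log_derivative(1)[OF a g(3) r nz ne1 root less F dF' E0 dE zE'])
  moreover have "is_smallest_pos (convexity_eq_W k \<nu> c \<alpha>) r"
  proof (rule smallest_convexity_root[where
        \<kappa> = "\<lambda>z. convexity_series a 2 (1 / a) (2 / a) (of_real q * z ^ 2)", OF r _ root less])
    fix s assume "0 < s" "s < \<rho>"
    from convexity_eq_W_iff[where c = c and \<alpha> = \<alpha>, OF k \<nu> this, folded a_def q_def, OF nz ne1]
    show "convexity_eq_W k \<nu> c \<alpha> s \<longleftrightarrow>
      1 - convexity_series a 2 (1 / a) (2 / a) (of_real q * of_real s ^ 2) = of_real \<alpha>"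
      by blast
  qed
  ultimately show ?thesis unfolding F_def by blast
qed

theorem theorem1p3:
  fixes k c \<nu> \<alpha> :: real
  assumes "k > 0" and "c > 0" and "\<nu> > 0" and "0 \<le> \<alpha>" and "\<alpha> < 1"
  shows "(\<exists>r. is_smallest_pos (convexity_eq_W k \<nu> c \<alpha>) r \<and>
              radius_of_convexity \<alpha> (k_Bessel_f k \<nu> c) = ereal r) \<and>
         (\<exists>r. is_smallest_pos (convexity_eq (k_Bessel_g k \<nu> c) \<alpha>) r \<and>
              radius_of_convexity \<alpha> (k_Bessel_g k \<nu> c) = ereal r) \<and>
         (\<exists>r. is_smallest_pos (convexity_eq (k_Bessel_h k \<nu> c) \<alpha>) r \<and>
              radius_of_convexity \<alpha> (k_Bessel_h k \<nu> c) = ereal r)"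
proof (intro conjI)
  have aq: "\<nu> / k > 0" "c / (4 * k) > 0" using assms by auto
  show "\<exists>r. is_smallest_pos (convexity_eq_W k \<nu> c \<alpha>) r \<and>
          radius_of_convexity \<alpha> (k_Bessel_f k \<nu> c) = ereal r"
    by (rule convexity_radius_k_Bessel_f[OF assms])
  have g: "k_Bessel_g k \<nu> c = (\<lambda>z. z * bessel_phi (\<nu> / k) (of_real (c / (4 * k)) * z ^ 2))"
    using k_Bessel_g_eq[OF assms(1,3)] by blast
  show "\<exists>r. is_smallest_pos (convexity_eq (k_Bessel_g k \<nu> c) \<alpha>) r \<and>
          radius_of_convexity \<alpha> (k_Bessel_g k \<nu> c) = ereal r"
    unfolding g by (rule convexity_radius_z_bessel_phi[OF aq(1) _ aq(2) assms(4,5)]) simp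
  have h: "k_Bessel_h k \<nu> c = (\<lambda>z. z * bessel_phi (\<nu> / k) (of_real (c / (4 * k)) * z ^ 1))"
    using k_Bessel_h_eq[OF assms(1,3)] by blast
  show "\<exists>r. is_smallest_pos (convexity_eq (k_Bessel_h k \<nu> c) \<alpha>) r \<and>
          radius_of_convexity \<alpha> (k_Bessel_h k \<nu> c) = ereal r"
    unfolding h by (rule convexity_radius_z_bessel_phi[OF aq(1) _ aq(2) assms(4,5)]) simp
qed

end
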